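(* For any $c>0$, there is an online factorization algorithm in the row arrival model such that, for any $m\times N$ real matrix $Q$ with rows $q_1,\ldots,q_m$, the algorithm achieves factorization value \[ \gamma = O\left(\gamma_2(Q)\log(\gamma_2(Q)/\|q_1\|_\infty)^{\frac12+c}\log(N)^3\right). \] Moreover, there is an online factorization algorithm in the column arrival model such that, for any $m\times N$ real matrix $A$, the algorithm achieves factorization value $\gamma = O(\gamma_2(A)\log(m)^3)$.
   Context: For a matrix, $\|R\|_{1\to2}$ is the maximum $\ell_2$ norm of a column, $\|L\|_{2\to\infty}$ the maximum $\ell_2$ norm of a row, $\|R\|_F$ the Frobenius norm, and $\gamma_2(A)=\min\{\|L\|_{2\to\infty}\|R\|_{1\to2}:LR=A\}$. Row arrival model: the rows $q_1,q_2,\ldots$ (row vectors in $\mathbb{R}^N$) of $Q$ arrive one at a time, and the number of rows $m$ is not known to the algorithm. The algorithm chooses an initial (possibly empty) matrix $R_0$ with $N$ columns. At step $t$, after receiving $q_t$, it forms $R_t$ by appending rows to $R_{t-1}$, and outputs a row vector $\ell_t$ (of dimension equal to the number of rows of $R_t$) with $\ell_tR_t=q_t$. It must hold that $\|R_t\|_{1\to2}\le1$ for all $t$. $L_t$ denotes the matrix with rows $\ell_1,\ldots,\ell_t$ padded with zeros, so $L_tR_t=Q_t$, the matrix of the first $t$ rows. The algorithm achieves factorization value $\gamma$ if $\max_t\|\ell_t\|_2\le\gamma$. Column arrival model: the columns $a_1,a_2,\ldots\in\mathbb{R}^m$ of $A$ arrive one at a time. The algorithm chooses an initial (possibly empty)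 matrix $L_0$ with $m$ rows; at step $t$ it forms $L_t$ by appending columns to $L_{t-1}$ and outputs a column vector $r_t$ with $L_tr_t=a_t$ and $\|r_t\|_2\le1$ (so the matrix $R_t$ of zero-padded columns $r_1,\ldots,r_t$ satisfies $L_tR_t=A_t$, $\|R_t\|_{1\to2}\le 1$). The factorization value is $\gamma=\|L_N\|_{2\to\infty}$, where $N$ is the total number of columns. *)

theory Defs
  imports Complex_Main
begin

text \<open>Vectors are real lists; a matrix is a list of its rows (each of the given length).\<close>

definition norm2 :: "real list \<Rightarrow> real" where
  "norm2 xs = sqrt (sum_list (map (\<lambda>x. x\<^sup>2) xs))"

definition linf :: "real list \<Rightarrow> real" where
  "linf xs = Max (insert 0 (abs ` set xs))"

definition is_mat :: "nat \<Rightarrow> nat \<Rightarrow> real list list \<Rightarrow> bool" where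
  "is_mat m n M \<longleftrightarrow> length M = m \<and> (\<forall>r\<in>set M. length r = n)"

definition vecmat :: "real list \<Rightarrow> real list list \<Rightarrow> nat \<Rightarrow> real list" where
  "vecmat l R N = map (\<lambda>j. \<Sum>i<length R. l ! i * (R ! i ! j)) [0..<N]"

definition matmul :: "real list list \<Rightarrow> real list list \<Rightarrow> nat \<Rightarrow> real list list" where
  "matmul L R N = map (\<lambda>l. vecmat l R N) L"

definition col :: "nat \<Rightarrow> real list list \<Rightarrow> real list" where
  "col j R = map (\<lambda>r. r ! j) R"

definition norm_1to2 :: "real list list \<Rightarrow> nat \<Rightarrow> real" where
  "norm_1to2 R N = Max (insert 0 ((\<lambda>j. norm2 (col j R)) ` {..<N}))"

definition norm_2toinf :: "real list list \<Rightarrow> real" where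
  "norm_2toinf L = Max (insert 0 (norm2 ` set L))"

definition gamma2 :: "real list list \<Rightarrow> nat \<Rightarrow> real" where
  "gamma2 Q N = Inf {norm_2toinf L * norm_1to2 R N | L R k.
      is_mat (length Q) k L \<and> is_mat k N R \<and> matmul L R N = Q}"

text \<open>An online algorithm: an initial matrix R0 and a step function which, given
  the rows q_1..q_t received so far, returns the rows appended at step t and the
  output vector l_t.\<close>
type_synonym online_alg = "real list list \<times> (real list list \<Rightarrow> real list list \<times> real list)"

definition acc_mat :: "online_alg \<Rightarrow> real list list \<Rightarrow> nat \<Rightarrow> real list list" where
  "acc_mat alg qs t = fst alg @ concat (map (\<lambda>i. fst (snd alg (take i qs))) [1..<Suc t])"

definition out_vec :: "online_alg \<Rightarrow> real list list \<Rightarrow> nat \<Rightarrow> real list" where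
  "out_vec alg qs t = snd (snd alg (take t qs))"

definition row_valid :: "nat \<Rightarrow> online_alg \<Rightarrow> bool" where
  "row_valid N alg \<longleftrightarrow>
    (\<forall>qs. (\<forall>q\<in>set qs. length q = N) \<longrightarrow>
      (\<forall>t\<le>length qs. is_mat (length (acc_mat alg qs t)) N (acc_mat alg qs t)
                       \<and> norm_1to2 (acc_mat alg qs t) N \<le> 1) \<and>
      (\<forall>t. 1 \<le> t \<and> t \<le> length qs \<longrightarrow>
         length (out_vec alg qs t) = length (acc_mat alg qs t) \<and>
         vecmat (out_vec alg qs t) (acc_mat alg qs t) N = qs ! (t - 1)))"

definition row_value :: "online_alg \<Rightarrow> real list list \<Rightarrow> real" where
  "row_value alg qs = Max (insert 0 ((\<lambda>t. norm2 (out_vec alg qs t)) ` {1..length qs}))"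

text \<open>Here the accumulated matrix L_t is represented by the list of its columns
  (each of length m); the output vector r_t satisfies L_t r_t = a_t.\<close>

definition col_valid :: "nat \<Rightarrow> online_alg \<Rightarrow> bool" where
  "col_valid m alg \<longleftrightarrow>
    (\<forall>as. (\<forall>a\<in>set as. length a = m) \<longrightarrow>
      (\<forall>t\<le>length as. is_mat (length (acc_mat alg as t)) m (acc_mat alg as t)) \<and>
      (\<forall>t. 1 \<le> t \<and> t \<le> length as \<longrightarrow>
         length (out_vec alg as t) = length (acc_mat alg as t) \<and>
         vecmat (out_vec alg as t) (acc_mat alg as t) m = as ! (t - 1) \<and>
         norm2 (out_vec alg as t) \<le> 1))"

text \<open>Factorization value: max row norm of the final L_N (rows of L = columns of
  its column list).\<close>
definition col_value :: "nat \<Rightarrow> online_alg \<Rightarrow> real list list \<Rightarrow> real" where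
  "col_value m alg as = norm_1to2 (acc_mat alg as (length as)) m"

definition rows_of_cols :: "nat \<Rightarrow> real list list \<Rightarrow> real list list" where
  "rows_of_cols m as = map (\<lambda>i. map (\<lambda>a. a ! i) as) [0..<m]"

end

theory Submission
  imports Defs "HOL-Analysis.Harmonic_Numbers"
begin

text \<open>
  Both models ask to cover the arriving vectors \<open>a\<close> by an append-only list of columns with Gram matrix
  \<open>M\<close>, i.e. \<open>a a\<^sup>T \<le> M\<close>, with small diagonal.  A factorization of value \<open>g\<close> provides a comparator
  \<open>M*\<close> with \<open>a a\<^sup>T \<le> M*\<close> for all \<open>a\<close> and diagonal at most \<open>g\<^sup>2\<close>; the value \<open>g\<close> is guessed up to powers of 2
  (in the row model the unit budget for the norm of \<open>R\<close> is split between the guesses by the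
  weights \<open>k powr -(1 + 2c)\<close>).

  For a fixed guess, scaled to \<open>g = 1\<close>, start with \<open>M = 1\<close> and use the potential
  \<open>\<Sum>s. s tr (M* (M + s / W)\<^sup>-\<^sup>1)\<close> over \<open>O(log d)\<close> dyadic scales \<open>s\<close>, where \<open>W\<close> is a diagonal weight.
  If \<open>a\<close> is not in the ellipsoid of \<open>M\<close>, then at some scale \<open>v = s W\<^sup>-\<^sup>1 (M + s / W)\<^sup>-\<^sup>1 a\<close> has
  \<open>v\<^sup>T W v / s \<ge> \<Omega>(1 / log d)\<close>, and adding a multiple of \<open>v v\<^sup>T\<close> that increases \<open>tr (W M)\<close> by 1 decreases the
  potential by \<open>\<Omega>(1 / log d)\<close>.  When a diagonal entry of \<open>M\<close> exceeds a threshold of order \<open>log\<^sup>2 d\<close>, its row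
  and column are replaced by those of the identity and its weight is doubled.  This increases the potential only
  in proportion to the weight, so that the total weight stays below \<open>2 d\<close> and every coordinate is reset
  \<open>O(log d)\<close> times.  Columns cannot be withdrawn, hence the parts of the columns cut off by the resets
  have to be corrected for; this is done by \<open>O(log d)\<close> dyadic blocks of resets.
\<close>

section \<open>Symmetric linear systems\<close>

definition dot :: "nat \<Rightarrow> (nat \<Rightarrow> real) \<Rightarrow> (nat \<Rightarrow> real) \<Rightarrow> real" where
  "dot d x y = (\<Sum>i<d. x i * y i)"

definition mv :: "nat \<Rightarrow> (nat \<Rightarrow> nat \<Rightarrow> real) \<Rightarrow> (nat \<Rightarrow> real) \<Rightarrow> nat \<Rightarrow> real" where
  "mv d A x i = (\<Sum>j<d. A i j * x j)"

definition solves :: "nat \<Rightarrow> (nat \<Rightarrow> nat \<Rightarrow> real) \<Rightarrow> (nat \<Rightarrow> real) \<Rightarrow> (nat \<Rightarrow> real) \<Rightarrow> bool" where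
  "solves d A x y \<longleftrightarrow> (\<forall>i<d. mv d A y i = x i)"

definition symm :: "nat \<Rightarrow> (nat \<Rightarrow> nat \<Rightarrow> real) \<Rightarrow> bool" where
  "symm d A \<longleftrightarrow> (\<forall>i<d. \<forall>j<d. A i j = A j i)"

text \<open>The form \<open>x\<^sup>T A\<^sup>-\<^sup>1 x\<close> without an inverse matrix: for
  symmetric \<open>A\<close> every solution of the system gives the same value
  (\<open>inv_form_eq\<close>).\<close>

definition inv_form :: "nat \<Rightarrow> (nat \<Rightarrow> nat \<Rightarrow> real) \<Rightarrow> (nat \<Rightarrow> real) \<Rightarrow> real" where
  "inv_form d A x = dot d x (SOME y. solves d A x y)"

lemma dot_commute: "dot d x y = dot d y x"
  by (simp add: dot_def mult.commute)

lemma dot_cong: "(\<And>i. i < d \<Longrightarrow> x i = x' i) \<Longrightarrow> (\<And>i. i < d \<Longrightarrow> y i = y' i) \<Longrightarrow> dot d x y = dot d x' y'"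
  by (simp add: dot_def)

lemma dot_add_right: "dot d x (\<lambda>i. y i + z i) = dot d x y + dot d x z"
  by (simp add: dot_def sum.distrib algebra_simps)

lemma dot_diff_right: "dot d x (\<lambda>i. y i - z i) = dot d x y - dot d x z"
  by (simp add: dot_def sum_subtractf algebra_simps)

lemma dot_scale_right: "dot d x (\<lambda>i. c * y i) = c * dot d x y"
  by (simp add: dot_def sum_distrib_left algebra_simps)

lemma dot_unit: "k < d \<Longrightarrow> dot d x (\<lambda>i. if i = k then c else 0) = x k * c"
  by (simp add: dot_def if_distrib cong: if_cong)

lemma dot_self_nonneg: "0 \<le> dot d x x"
  by (simp add: dot_def sum_nonneg)

lemma mv_diff: "mv d A (\<lambda>i. x i - y i) i = mv d A x i - mv d A y i"
  by (simp add: mv_def sum_subtractf algebra_simps)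

lemma mv_scale: "mv d A (\<lambda>i. c * x i) i = c * mv d A x i"
  by (simp add: mv_def sum_distrib_left algebra_simps)

lemma dot_mv_symm:
  assumes "symm d A"
  shows "dot d x (mv d A y) = dot d y (mv d A x)"
proof -
  have "dot d x (mv d A y) = (\<Sum>i<d. \<Sum>j<d. x i * A i j * y j)"
    by (simp add: dot_def mv_def sum_distrib_left mult.assoc)
  also have "\<dots> = (\<Sum>j<d. \<Sum>i<d. x i * A i j * y j)"
    by (rule sum.swap)
  also have "\<dots> = (\<Sum>j<d. \<Sum>i<d. y j * (A j i * x i))"
    using assms by (intro sum.cong refl) (auto simp: symm_def)
  also have "\<dots> = dot d y (mv d A x)"
    by (simp add: dot_def mv_def sum_distrib_left)
  finally show ?thesis .
qed

lemma dot_solves: "solves d A x y \<Longrightarrow> dot d z (mv d A y) = dot d z x"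
  by (intro dot_cong) (auto simp: solves_def)

lemma solves_symm:
  assumes "symm d A" "solves d A x y" "solves d A x' y'"
  shows "dot d x y' = dot d x' y"
  using dot_mv_symm[OF assms(1), of y y'] dot_solves[OF assms(2), of y'] dot_solves[OF assms(3), of y]
  by (simp add: dot_commute)

lemma inv_form_eq:
  assumes "symm d A" "solves d A x y"
  shows "inv_form d A x = dot d x y"
  unfolding inv_form_def
  using solves_symm[OF assms(1), of x "SOME y. solves d A x y" x y] assms(2) someI[of "solves d A x" y]
  by auto

text \<open>Expand the nonnegative form of \<open>A\<close> at \<open>y - u\<close>. The inverse
  form is thus the maximum of the left-hand side over \<open>u\<close>, so any trial
  \<open>u\<close> gives a lower bound.\<close>

lemma inv_form_variational:
  assumes "symm d A" "\<And>u. dot d u (mv d A u) \<ge> 0" "solves d A x y"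
  shows "2 * dot d x u - dot d u (mv d A u) \<le> dot d x y"
proof -
  have "0 \<le> dot d (\<lambda>i. y i - u i) (mv d A (\<lambda>i. y i - u i))"
    by (rule assms(2))
  also have "\<dots> = dot d (\<lambda>i. y i - u i) (\<lambda>i. mv d A y i - mv d A u i)"
    by (intro dot_cong) (simp_all add: mv_diff)
  also have "\<dots> = dot d y (mv d A y) - dot d u (mv d A y) - dot d y (mv d A u) + dot d u (mv d A u)"
    by (simp add: dot_diff_right dot_commute[of _ "\<lambda>i. y i - u i"]) (simp add: dot_commute)
  also have "dot d y (mv d A u) = dot d u (mv d A y)"
    by (rule dot_mv_symm[OF assms(1)])
  finally show ?thesis
    using dot_solves[OF assms(3), of y] dot_solves[OF assms(3), of u] by (simp add: dot_commute)
qed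

text \<open>Sherman-Morrison formula at the level of solutions, with \<open>z\<close> in the role of
  the inverse applied to \<open>v\<close>.\<close>

lemma solves_rank_one_update:
  assumes "symm d A" "solves d A v z" "solves d A x y" "0 \<le> \<delta>" "0 \<le> dot d v z"
  defines "c \<equiv> \<delta> / (1 + \<delta> * dot d v z)"
  shows "solves d (\<lambda>i j. A i j + \<delta> * (v i * v j)) x (\<lambda>i. y i - c * dot d v y * z i)"
proof -
  have nz: "1 + \<delta> * dot d v z > 0" using assms(4,5) by (smt (verit) mult_nonneg_nonneg)
  have "mv d (\<lambda>i j. A i j + \<delta> * (v i * v j)) u i = mv d A u i + \<delta> * v i * dot d v u" for u i
    by (simp add: mv_def dot_def sum.distrib sum_distrib_left algebra_simps)
  moreover have "mv d A (\<lambda>i. y i - c * dot d v y * z i) i = x i - c * dot d v y * v i" if "i < d" for i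
    using assms(2,3) that by (simp add: mv_diff mv_scale solves_def)
  moreover have "dot d v (\<lambda>i. y i - c * dot d v y * z i) = dot d v y - c * dot d v y * dot d v z"
    by (simp add: dot_diff_right dot_scale_right)
  moreover have "- c + \<delta> * (1 - c * dot d v z) = 0"
    using nz by (simp add: c_def field_simps)
  hence "x i - c * dot d v y * v i + \<delta> * v i * (dot d v y - c * dot d v y * dot d v z) = x i" for i
    by algebra
  ultimately show ?thesis
    by (simp add: solves_def)
qed

lemma symm_rank_one_update: "symm d A \<Longrightarrow> symm d (\<lambda>i j. A i j + \<delta> * (v i * v j))"
  by (simp add: symm_def)

lemma inv_form_rank_one_update:
  assumes "symm d A" "solves d A v z" "solves d A x y" "0 \<le> \<delta>" "0 \<le> dot d v z"
  shows "inv_form d (\<lambda>i j. A i j + \<delta> * (v i * v j)) x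
    = inv_form d A x - \<delta> / (1 + \<delta> * dot d v z) * (dot d z x)\<^sup>2"
proof -
  have "dot d v y = dot d z x"
    using solves_symm[OF assms(1,2,3)] by (simp add: dot_commute)
  thus ?thesis
    unfolding inv_form_eq[OF symm_rank_one_update[OF assms(1)] solves_rank_one_update[OF assms]]
      inv_form_eq[OF assms(1,3)]
    by (simp only: dot_diff_right dot_scale_right dot_commute[of d x z] power2_eq_square mult.assoc)
qed

section \<open>Decoupling one coordinate of a linear system\<close>

definition decouple :: "nat \<Rightarrow> real \<Rightarrow> (nat \<Rightarrow> nat \<Rightarrow> real) \<Rightarrow> nat \<Rightarrow> nat \<Rightarrow> real" where
  "decouple k c A i j = (if i = k \<and> j = k then c else if i = k \<or> j = k then 0 else A i j)"

lemma symm_decouple: "symm d A \<Longrightarrow> symm d (decouple k c A)"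
  by (auto simp: symm_def decouple_def)

lemma mv_decouple:
  assumes "k < d"
  shows "mv d (decouple k c A) u i = (if i = k then c * u k else mv d A (u(k := 0)) i)"
proof (cases "i = k")
  case True
  thus ?thesis using assms by (simp add: mv_def decouple_def if_distrib[of "\<lambda>x. x * _"] cong: if_cong)
next
  case False
  thus ?thesis by (auto simp: mv_def decouple_def intro!: sum.cong)
qed

text \<open>\<open>g\<close> is the \<open>k\<close>-th column of the inverse. Subtracting
  \<open>y k / g k\<close> times it makes the \<open>k\<close>-th coordinate vanish and disturbs
  only the \<open>k\<close>-th equation, which the decoupled matrix replaces.\<close>

lemma solves_decouple:
  assumes "solves d A x y" "solves d A (\<lambda>i. if i = k then 1 else 0) g"
    and "k < d" "c \<noteq> 0" "g k \<noteq> 0"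
  shows "solves d (decouple k c A) x (\<lambda>i. y i - y k / g k * g i + (if i = k then x k / c else 0))"
proof -
  let ?u = "\<lambda>i. y i - y k / g k * g i + (if i = k then x k / c else 0)"
  have u: "?u(k := 0) = (\<lambda>i. y i - y k / g k * g i)"
    using assms(5) by auto
  show ?thesis
    unfolding solves_def mv_decouple[OF assms(3)] u mv_diff mv_scale
    using assms by (auto simp: solves_def)
qed

text \<open>Forcing coordinate \<open>k\<close> of the solution to zero lowers the form by
  \<open>(y k)\<^sup>2 / g k\<close>, and the separate equation for coordinate \<open>k\<close> adds
  \<open>(x k)\<^sup>2 / c\<close>.\<close>

lemma inv_form_decouple:
  assumes "symm d A" "solves d A x y" "solves d A (\<lambda>i. if i = k then 1 else 0) g"
    and "k < d" "c \<noteq> 0" "g k > 0"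
  shows "inv_form d (decouple k c A) x \<le> inv_form d A x + (x k)\<^sup>2 / c"
proof -
  have "dot d x g = y k"
    using solves_symm[OF assms(1,2,3)] dot_unit[OF assms(4), of y 1] by (simp add: dot_commute)
  hence "inv_form d (decouple k c A) x = inv_form d A x - y k * y k / g k + (x k)\<^sup>2 / c"
    using inv_form_eq[OF symm_decouple[OF assms(1)] solves_decouple[OF assms(2-5)]] inv_form_eq[OF assms(1,2)] assms(6)
    by (simp only: dot_add_right dot_diff_right dot_scale_right dot_unit[OF assms(4)]) (simp add: power2_eq_square)
  thus ?thesis using assms(6) by simp
qed

lemma dot_mv_decouple:
  assumes "k < d"
  shows "dot d u (mv d (decouple k c A) u) = c * (u k)\<^sup>2 + dot d (u(k := 0)) (mv d A (u(k := 0)))"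
proof -
  have "dot d u (mv d (decouple k c A) u)
      = (\<Sum>i<d. (if i = k then c * (u k)\<^sup>2 else 0) + (u(k := 0)) i * mv d A (u(k := 0)) i)"
    unfolding dot_def mv_decouple[OF assms] by (intro sum.cong) (auto simp: power2_eq_square)
  thus ?thesis using assms by (simp add: sum.distrib dot_def)
qed

lemma dot_self_split:
  assumes "k < d"
  shows "dot d u u = (u k)\<^sup>2 + dot d (u(k := 0)) (u(k := 0))"
proof -
  have "dot d u u = (\<Sum>i<d. (if i = k then (u k)\<^sup>2 else 0) + (u(k := 0)) i * (u(k := 0)) i)"
    unfolding dot_def by (intro sum.cong) (auto simp: power2_eq_square)
  thus ?thesis using assms by (simp add: sum.distrib dot_def)
qed

section \<open>The potential\<close>

definition shifted :: "(nat \<Rightarrow> nat \<Rightarrow> real) \<Rightarrow> (nat \<Rightarrow> real) \<Rightarrow> real \<Rightarrow> nat \<Rightarrow> nat \<Rightarrow> real" where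
  "shifted M w s i j = M i j + (if i = j then s / w i else 0)"

text \<open>Solvability of all shifted systems is part of the invariant, since the updates carry it
  along by explicit solution formulas.\<close>

definition admissible :: "nat \<Rightarrow> (nat \<Rightarrow> nat \<Rightarrow> real) \<Rightarrow> (nat \<Rightarrow> real) \<Rightarrow> bool" where
  "admissible d M w \<longleftrightarrow> symm d M \<and> (\<forall>u. dot d u u \<le> dot d u (mv d M u)) \<and> (\<forall>i<d. 1 \<le> w i)
     \<and> (\<forall>s\<ge>0. \<forall>x. \<exists>y. solves d (shifted M w s) x y)"

definition scale :: "nat \<Rightarrow> real" where
  "scale k = 2 ^ k / 2"

text \<open>The comparator matrix is given as the sum of the rank one matrices of the vectors
  \<open>b p\<close>, so that traces become sums of inverse forms.\<close>

definition potential ::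
  "nat \<Rightarrow> nat \<Rightarrow> (nat \<Rightarrow> nat \<Rightarrow> real) \<Rightarrow> nat \<Rightarrow> (nat \<Rightarrow> nat \<Rightarrow> real) \<Rightarrow> (nat \<Rightarrow> real) \<Rightarrow> real" where
  "potential d P b K M w = (\<Sum>k\<le>K. scale k * (\<Sum>p<P. inv_form d (shifted M w (scale k)) (b p)))"

text \<open>The form of the shift at \<open>y\<close>. If \<open>y\<close> solves the system for
  \<open>a\<close>, this is \<open>- s\<close> times the derivative of the inverse form of
  \<open>a\<close> with respect to \<open>s\<close>, and it is \<open>v\<^sup>T W v / s\<close> for
  the direction \<open>v = s y / w\<close>.\<close>

definition strength :: "nat \<Rightarrow> (nat \<Rightarrow> real) \<Rightarrow> real \<Rightarrow> (nat \<Rightarrow> real) \<Rightarrow> real" where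
  "strength d w s y = s * (\<Sum>i<d. (y i)\<^sup>2 / w i)"

lemma scale_pos: "0 < scale k" and scale_ge: "1 / 2 \<le> scale k" and scale_Suc: "scale (Suc k) = 2 * scale k"
  by (simp_all add: scale_def)

lemma symm_shifted: "symm d M \<Longrightarrow> symm d (shifted M w s)"
  by (simp add: symm_def shifted_def)

lemma mv_shifted: "i < d \<Longrightarrow> mv d (shifted M w s) u i = mv d M u i + s / w i * u i"
  by (simp add: mv_def shifted_def sum.distrib distrib_right if_distrib[of "\<lambda>x. x * _"] cong: if_cong)

lemma shifted_form: "dot d u (mv d (shifted M w s) u) = dot d u (mv d M u) + strength d w s u"
proof -
  have "dot d u (mv d (shifted M w s) u) = (\<Sum>i<d. u i * mv d M u i + s * ((u i)\<^sup>2 / w i))"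
    unfolding dot_def by (intro sum.cong) (simp_all add: mv_shifted power2_eq_square algebra_simps)
  thus ?thesis
    by (simp add: sum.distrib sum_distrib_left dot_def strength_def)
qed

lemma shifted_0: "shifted M w 0 = M"
  by (intro ext) (simp add: shifted_def)

lemma strength_nonneg: "(\<And>i. i < d \<Longrightarrow> 1 \<le> w i) \<Longrightarrow> 0 \<le> s \<Longrightarrow> 0 \<le> strength d w s y"
  unfolding strength_def by (intro mult_nonneg_nonneg sum_nonneg divide_nonneg_nonneg) fastforce+

section \<open>Shifted systems of an admissible matrix\<close>

context
  fixes d M w
  assumes adm: "admissible d M w"
begin

lemma adm_symm: "symm d (shifted M w s)"
  using adm by (simp add: admissible_def symm_shifted)

lemma adm_w: "i < d \<Longrightarrow> 1 \<le> w i"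
  using adm by (simp add: admissible_def)

lemma adm_form_ge: "dot d u u \<le> dot d u (mv d M u)"
  using adm by (simp add: admissible_def)

lemma adm_form_nonneg: "0 \<le> s \<Longrightarrow> 0 \<le> dot d u (mv d (shifted M w s) u)"
  using adm_form_ge[of u] dot_self_nonneg[of d u] strength_nonneg[of d w s u, OF adm_w] by (simp add: shifted_form)

lemma adm_solve:
  assumes "0 \<le> s" obtains y where "solves d (shifted M w s) x y"
  using adm assms unfolding admissible_def by blast

lemma adm_dot_nonneg:
  assumes "0 \<le> s" "solves d (shifted M w s) x y"
  shows "0 \<le> dot d x y"
  using adm_form_nonneg[OF assms(1), of y] dot_solves[OF assms(2), of y] by (simp add: dot_commute)

lemma adm_inv_form_nonneg:
  assumes "0 \<le> s" shows "0 \<le> inv_form d (shifted M w s) x"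
  using adm_solve[OF assms, of x] inv_form_eq[OF adm_symm] adm_dot_nonneg[OF assms] by metis

lemma adm_strength_le:
  assumes "0 \<le> s" "solves d (shifted M w s) x y"
  shows "dot d y y + strength d w s y \<le> dot d x y"
  using adm_form_ge[of y] dot_solves[OF assms(2), of y] by (simp add: shifted_form dot_commute)

text \<open>The shifted matrix dominates its diagonal part \<open>s / W\<close>, so its inverse is
  at most \<open>W / s\<close>; the proof completes the square for this comparison.\<close>

lemma adm_dot_le:
  assumes s: "0 < s" and y: "solves d (shifted M w s) x y"
  shows "dot d x y \<le> (\<Sum>i<d. w i * (x i)\<^sup>2) / s"
proof -
  have "0 \<le> (\<Sum>i<d. s / w i * (y i - w i * x i / s)\<^sup>2)"
    using adm_w s by (intro sum_nonneg mult_nonneg_nonneg divide_nonneg_nonneg) fastforce+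
  also have "\<dots> = (\<Sum>i<d. s * ((y i)\<^sup>2 / w i) - 2 * (x i * y i) + w i * (x i)\<^sup>2 / s)"
    using adm_w s by (intro sum.cong refl) (fastforce simp: field_simps power2_eq_square)
  also have "\<dots> = strength d w s y - 2 * dot d x y + (\<Sum>i<d. w i * (x i)\<^sup>2) / s"
    by (simp add: sum.distrib sum_subtractf strength_def dot_def sum_distrib_left sum_divide_distrib)
  finally show ?thesis
    using adm_strength_le[OF less_imp_le[OF s] y] dot_self_nonneg[of d y] by simp
qed

text \<open>Test the variational bound for the shift \<open>2 * s\<close> with the solution for the
  shift \<open>s\<close>.\<close>

lemma inv_form_double_shift:
  assumes s: "0 < s" and y: "solves d (shifted M w s) a y"
  shows "inv_form d (shifted M w s) a - strength d w s y \<le> inv_form d (shifted M w (2 * s)) a"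
proof -
  obtain y' where y': "solves d (shifted M w (2 * s)) a y'" using s by (auto intro: adm_solve[of "2 * s" a])
  have "2 * dot d a y - dot d y (mv d (shifted M w (2 * s)) y) \<le> dot d a y'"
    using s by (intro inv_form_variational[OF adm_symm _ y'] adm_form_nonneg) simp
  moreover have "dot d y (mv d (shifted M w (2 * s)) y) = dot d a y + strength d w s y"
    using dot_solves[OF y, of y] by (simp add: shifted_form dot_commute strength_def algebra_simps)
  ultimately show ?thesis
    by (simp add: inv_form_eq[OF adm_symm y] inv_form_eq[OF adm_symm y'])
qed

text \<open>Weights are at least 1 and \<open>M\<close> dominates the identity, so the shift by
  \<open>1 / 2\<close> raises the form of \<open>M\<close> by a factor of at most
  \<open>3 / 2\<close>. Testing the variational bound with the solution for \<open>M\<close> itself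
  leaves the fraction \<open>2 - 3 / 2\<close>.\<close>

lemma inv_form_half_shift: "inv_form d M a \<le> 2 * inv_form d (shifted M w (1 / 2)) a"
proof -
  obtain y where y: "solves d M a y" using adm_solve[of 0 a] by (auto simp: shifted_0)
  obtain y' where y': "solves d (shifted M w (1 / 2)) a y'" by (auto intro: adm_solve[of "1 / 2" a])
  have "strength d w (1 / 2) y \<le> 1 / 2 * dot d y y"
    unfolding strength_def dot_def
  proof (intro mult_left_mono sum_mono)
    fix i assume "i \<in> {..<d}"
    hence "1 \<le> w i" using adm_w by simp
    hence "(y i)\<^sup>2 * 1 \<le> (y i)\<^sup>2 * w i" by (intro mult_left_mono) simp_all
    thus "(y i)\<^sup>2 / w i \<le> y i * y i" using \<open>1 \<le> w i\<close> by (simp add: field_simps power2_eq_square)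
  qed simp
  also have "\<dots> \<le> 1 / 2 * dot d a y"
    using adm_form_ge[of y] dot_solves[OF y, of y] by (simp add: dot_commute)
  finally have "strength d w (1 / 2) y \<le> 1 / 2 * dot d a y" .
  moreover have "2 * dot d a y - dot d y (mv d (shifted M w (1 / 2)) y) \<le> dot d a y'"
    by (intro inv_form_variational[OF adm_symm _ y'] adm_form_nonneg) simp
  moreover have "dot d y (mv d (shifted M w (1 / 2)) y) = dot d a y + strength d w (1 / 2) y"
    using dot_solves[OF y, of y] by (simp add: shifted_form dot_commute)
  moreover have "inv_form d M a = dot d a y"
    using inv_form_eq[OF adm_symm[of 0]] y by (simp add: shifted_0)
  ultimately show ?thesis
    by (simp add: inv_form_eq[OF adm_symm y'])
qed

text \<open>If \<open>a\<close> is weak at every scale, then telescoping over the scales shows that \<open>a\<close> lies in the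
  ellipsoid of \<open>M\<close>.\<close>

lemma inv_form_le_1:
  assumes weak: "\<And>k y. k \<le> K \<Longrightarrow> solves d (shifted M w (scale k)) a y \<Longrightarrow> strength d w (scale k) y \<le> 1 / (4 * (real K + 1))"
    and large: "4 * (\<Sum>i<d. w i * (a i)\<^sup>2) \<le> scale (Suc K)"
  shows "inv_form d M a \<le> 1"
proof -
  \<comment> \<open>The \<open>Suc K\<close> doublings cost \<open>1 / 4\<close> in total, and the
    largest scale contributes at most another \<open>1 / 4\<close>. The sum \<open>1 / 2\<close>
    becomes 1 on removing the smallest shift.\<close>
  have "inv_form d (shifted M w (scale 0)) a \<le> inv_form d (shifted M w (scale n)) a + real n / (4 * (real K + 1))"
    if "n \<le> Suc K" for n using that
  proof (induction n)
    case (Suc n)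
    obtain y where y: "solves d (shifted M w (scale n)) a y"
      using scale_pos[of n] by (auto intro: adm_solve[of "scale n" a])
    have "real (Suc n) / (4 * (real K + 1)) = real n / (4 * (real K + 1)) + 1 / (4 * (real K + 1))"
      by (simp add: add_divide_distrib)
    thus ?case
      using Suc inv_form_double_shift[OF scale_pos y] weak[OF _ y] by (simp add: scale_Suc)
  qed simp
  moreover have "real (Suc K) / (4 * (real K + 1)) = 1 / 4"
    by (simp add: field_simps)
  ultimately have "inv_form d (shifted M w (1 / 2)) a \<le> inv_form d (shifted M w (scale (Suc K))) a + 1 / 4"
    by (metis le_refl power_0 scale_def)
  moreover obtain y where y: "solves d (shifted M w (scale (Suc K))) a y"
    using scale_pos[of "Suc K"] by (auto intro: adm_solve[of "scale (Suc K)" a])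
  have "inv_form d (shifted M w (scale (Suc K))) a \<le> 1 / 4"
  proof -
    have "(\<Sum>i<d. w i * (a i)\<^sup>2) / scale (Suc K) \<le> 1 / 4"
      using large scale_pos[of "Suc K"] by (simp add: pos_divide_le_eq)
    thus ?thesis
      using adm_dot_le[OF scale_pos y] inv_form_eq[OF adm_symm y] by linarith
  qed
  ultimately show ?thesis
    using inv_form_half_shift[of a] by linarith
qed

section \<open>Rank one updates and decouplings of admissible matrices\<close>

lemma shifted_rank_one_update:
  "shifted (\<lambda>i j. M i j + \<delta> * (v i * v j)) w s = (\<lambda>i j. shifted M w s i j + \<delta> * (v i * v j))"
  by (intro ext) (simp add: shifted_def)

lemma admissible_rank_one_update:
  assumes "0 \<le> \<delta>"
  shows "admissible d (\<lambda>i j. M i j + \<delta> * (v i * v j)) w"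
  unfolding admissible_def
proof (intro conjI allI impI)
  show "symm d (\<lambda>i j. M i j + \<delta> * (v i * v j))"
    using adm by (simp add: admissible_def symm_rank_one_update)
  show "1 \<le> w i" if "i < d" for i
    using adm_w[OF that] .
  fix u
  have "mv d (\<lambda>i j. M i j + \<delta> * (v i * v j)) u i = mv d M u i + \<delta> * dot d v u * v i" for i
    by (simp add: mv_def dot_def sum.distrib sum_distrib_left algebra_simps)
  hence "dot d u (mv d (\<lambda>i j. M i j + \<delta> * (v i * v j)) u) = dot d u (mv d M u) + \<delta> * (dot d u v)\<^sup>2"
    by (simp add: dot_add_right dot_scale_right power2_eq_square dot_commute[of d v u] cong: dot_cong)
  thus "dot d u u \<le> dot d u (mv d (\<lambda>i j. M i j + \<delta> * (v i * v j)) u)"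
    using adm_form_ge[of u] assms by (metis add_increasing2 mult_nonneg_nonneg zero_le_power2)
next
  fix s x assume s: "0 \<le> (s::real)"
  obtain y where y: "solves d (shifted M w s) x y" using adm_solve[OF s] .
  obtain z where z: "solves d (shifted M w s) v z" using adm_solve[OF s] .
  show "\<exists>y. solves d (shifted (\<lambda>i j. M i j + \<delta> * (v i * v j)) w s) x y"
    unfolding shifted_rank_one_update
    using solves_rank_one_update[OF adm_symm z y assms adm_dot_nonneg[OF s z]] by blast
qed

lemma shifted_decouple:
  "shifted (decouple k 1 M) (w(k := 2 * w k)) s = decouple k (1 + s / (2 * w k)) (shifted M w s)"
  by (intro ext) (auto simp: shifted_def decouple_def)

text \<open>\<open>g k\<close> is a diagonal entry of the inverse, the pivot of the decoupling. It
  is at least the squared norm of \<open>g\<close>, and a vanishing \<open>g\<close> cannot solve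
  the system.\<close>

lemma adm_unit_solution_pos:
  assumes "k < d" "0 \<le> s" "solves d (shifted M w s) (\<lambda>i. if i = k then 1 else 0) g"
  shows "0 < g k"
proof -
  have gk: "dot d (\<lambda>i. if i = k then 1 else 0) g = g k"
    using dot_unit[OF assms(1), of g 1] by (simp add: dot_commute)
  have "dot d g g \<le> g k"
    using adm_strength_le[OF assms(2,3)] strength_nonneg[of d w s g, OF adm_w assms(2)] gk by simp
  moreover have "g k \<noteq> 0"
  proof
    assume "g k = 0"
    hence "(\<Sum>i<d. g i * g i) = 0"
      using \<open>dot d g g \<le> g k\<close> dot_self_nonneg[of d g] by (simp add: dot_def)
    hence "g i = 0" if "i < d" for i
      using that by (subst (asm) sum_nonneg_eq_0_iff) auto
    hence "mv d (shifted M w s) g k = 0" by (simp add: mv_def)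
    thus False using assms(1,3) by (simp add: solves_def)
  qed
  ultimately show ?thesis
    using dot_self_nonneg[of d g] by simp
qed

lemma admissible_decouple:
  assumes k: "k < d"
  shows "admissible d (decouple k 1 M) (w(k := 2 * w k))"
  unfolding admissible_def
proof (intro conjI allI impI)
  show "symm d (decouple k 1 M)"
    using adm by (simp add: admissible_def symm_decouple)
  show "1 \<le> (w(k := 2 * w k)) i" if "i < d" for i
    using adm_w[OF that] by auto
  show "dot d u u \<le> dot d u (mv d (decouple k 1 M) u)" for u
    using adm_form_ge[of "u(k := 0)"] by (simp only: dot_mv_decouple[OF k] dot_self_split[OF k, of u])
next
  fix s x assume s: "0 \<le> (s::real)"
  obtain y where y: "solves d (shifted M w s) x y" using adm_solve[OF s] .
  obtain g where g: "solves d (shifted M w s) (\<lambda>i. if i = k then 1 else 0) g" using adm_solve[OF s] .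
  have "0 \<le> s / (2 * w k)" using s adm_w[OF k] by simp
  thus "\<exists>y. solves d (shifted (decouple k 1 M) (w(k := 2 * w k)) s) x y"
    unfolding shifted_decouple
    using solves_decouple[OF y g k, of "1 + s / (2 * w k)"] adm_unit_solution_pos[OF k s g] by fastforce
qed

text \<open>At scale \<open>s\<close> the decoupled coordinate adds at most
  \<open>s / (1 + s / (2 * w k))\<close>, which is at most \<open>2 * w k\<close> whatever the
  scale.\<close>

lemma potential_decouple:
  assumes k: "k < d" and b: "(\<Sum>p<P. (b p k)\<^sup>2) \<le> 1"
  shows "potential d P b K (decouple k 1 M) (w(k := 2 * w k)) \<le> potential d P b K M w + (real K + 1) * (2 * w k)"
proof -
  have *: "scale l * (\<Sum>p<P. inv_form d (shifted (decouple k 1 M) (w(k := 2 * w k)) (scale l)) (b p))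
      \<le> scale l * (\<Sum>p<P. inv_form d (shifted M w (scale l)) (b p)) + 2 * w k" for l
  proof -
    let ?s = "scale l" let ?c = "1 + ?s / (2 * w k)"
    have wk: "1 \<le> w k" using adm_w[OF k] .
    have s: "0 < ?s" by (rule scale_pos)
    have c: "?c > 0" using wk s by (simp add: add_pos_pos)
    obtain g where g: "solves d (shifted M w ?s) (\<lambda>i. if i = k then 1 else 0) g"
      using adm_solve[OF less_imp_le[OF s]] .
    have "inv_form d (shifted (decouple k 1 M) (w(k := 2 * w k)) ?s) x \<le> inv_form d (shifted M w ?s) x + (x k)\<^sup>2 / ?c" for x
    proof -
      obtain y where y: "solves d (shifted M w ?s) x y" using adm_solve[OF less_imp_le[OF s]] .
      show ?thesis
        unfolding shifted_decouple using c
        by (intro inv_form_decouple[OF adm_symm y g k _ adm_unit_solution_pos[OF k less_imp_le[OF s] g]]) simp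
    qed
    hence "(\<Sum>p<P. inv_form d (shifted (decouple k 1 M) (w(k := 2 * w k)) ?s) (b p))
        \<le> (\<Sum>p<P. inv_form d (shifted M w ?s) (b p) + (b p k)\<^sup>2 / ?c)"
      by (intro sum_mono) blast
    also have "\<dots> = (\<Sum>p<P. inv_form d (shifted M w ?s) (b p)) + (\<Sum>p<P. (b p k)\<^sup>2) / ?c"
      by (simp add: sum.distrib sum_divide_distrib)
    also have "(\<Sum>p<P. (b p k)\<^sup>2) / ?c \<le> 1 / ?c"
      using b c by (intro divide_right_mono) simp_all
    finally have "?s * (\<Sum>p<P. inv_form d (shifted (decouple k 1 M) (w(k := 2 * w k)) ?s) (b p))
        \<le> ?s * ((\<Sum>p<P. inv_form d (shifted M w ?s) (b p)) + 1 / ?c)"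
      using s by simp
    moreover have "?s * (1 / ?c) \<le> 2 * w k"
      using s wk c by (simp add: field_simps)
    ultimately show ?thesis by (simp add: distrib_left)
  qed
  have "potential d P b K (decouple k 1 M) (w(k := 2 * w k))
      \<le> (\<Sum>l\<le>K. scale l * (\<Sum>p<P. inv_form d (shifted M w (scale l)) (b p)) + 2 * w k)"
    unfolding potential_def by (rule sum_mono) (rule *)
  thus ?thesis by (simp add: sum.distrib potential_def add.commute)
qed

lemma potential_nonneg: "0 \<le> potential d P b K M w"
  unfolding potential_def
  by (intro sum_nonneg mult_nonneg_nonneg adm_inv_form_nonneg) (simp_all add: less_imp_le[OF scale_pos])

text \<open>Since the change of the inverse has rank one, its value at \<open>a\<close> is dominated by its value on
  the comparator \<open>b\<close>.\<close>

lemma potential_step: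
  assumes k: "k \<le> K" and y: "solves d (shifted M w (scale k)) a y"
    and a: "\<And>u. (dot d u a)\<^sup>2 \<le> (\<Sum>p<P. (dot d u (b p))\<^sup>2)"
    and X: "X = strength d w (scale k) y" "0 < X"
    and v: "v = (\<lambda>i. scale k * y i / w i)" and \<delta>: "\<delta> = 1 / (scale k * X)"
  shows "potential d P b K (\<lambda>i j. M i j + \<delta> * (v i * v j)) w \<le> potential d P b K M w - X / 3"
    and "(\<Sum>i<d. w i * (\<delta> * (v i * v i))) = 1"
proof -
  let ?M' = "\<lambda>i j. M i j + \<delta> * (v i * v j)"
  define s where "s = scale k"
  have s: "0 < s" "1 / 2 \<le> s" unfolding s_def by (rule scale_pos scale_ge)+
  have \<delta>0: "0 < \<delta>" using s X(2) by (simp add: \<delta> s_def)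
  \<comment> \<open>Hence the normalization \<open>\<delta> = 1 / (scale k * X)\<close>: it makes
    the weighted trace grow by exactly 1.\<close>
  have wv: "(\<Sum>i<d. w i * (v i)\<^sup>2) = s * X"
    unfolding X strength_def sum_distrib_left v s_def[symmetric]
  proof (intro sum.cong refl)
    fix i assume "i \<in> {..<d}"
    hence "1 \<le> w i" using adm_w by simp
    thus "w i * (s * y i / w i)\<^sup>2 = s * (s * ((y i)\<^sup>2 / w i))" by (simp add: power2_eq_square field_simps)
  qed
  show "(\<Sum>i<d. w i * (\<delta> * (v i * v i))) = 1"
  proof -
    have "(\<Sum>i<d. w i * (\<delta> * (v i * v i))) = \<delta> * (\<Sum>i<d. w i * (v i)\<^sup>2)"
      by (simp add: sum_distrib_left power2_eq_square algebra_simps)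
    thus ?thesis using s X(2) by (simp add: wv \<delta> s_def)
  qed
  have vy: "dot d v y = X"
    unfolding X strength_def dot_def sum_distrib_left v
    by (intro sum.cong) (simp_all add: power2_eq_square)
  have decr: "inv_form d (shifted ?M' w t) x \<le> inv_form d (shifted M w t) x" if t: "0 \<le> t" for t x
  proof -
    obtain y' where y': "solves d (shifted M w t) x y'" using adm_solve[OF t] .
    obtain z where z: "solves d (shifted M w t) v z" using adm_solve[OF t] .
    show ?thesis
      unfolding shifted_rank_one_update
      using inv_form_rank_one_update[OF adm_symm z y' less_imp_le[OF \<delta>0] adm_dot_nonneg[OF t z]]
        \<delta>0 adm_dot_nonneg[OF t z] by simp
  qed
  obtain z where z: "solves d (shifted M w s) v z" using adm_solve[OF less_imp_le[OF s(1)]] .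
  \<comment> \<open>By symmetry of the inverse, pairing \<open>z\<close> with \<open>a\<close> is
    the same as pairing \<open>v\<close> with \<open>y\<close>.\<close>
  have za: "dot d z a = X"
    using solves_symm[OF adm_symm z y[folded s_def]] vy by (simp add: dot_commute)
  have vz0: "0 \<le> dot d v z" using adm_dot_nonneg[OF _ z] s by simp
  have vz: "dot d v z \<le> X"
    using adm_dot_le[OF s(1) z] s(1) by (simp add: wv)
  define c where "c = \<delta> / (1 + \<delta> * dot d v z)"
  have eq: "inv_form d (shifted ?M' w s) x = inv_form d (shifted M w s) x - c * (dot d z x)\<^sup>2" for x
  proof -
    obtain y' where y': "solves d (shifted M w s) x y'" using adm_solve[OF less_imp_le[OF s(1)]] .
    show ?thesis
      unfolding shifted_rank_one_update c_def
      by (rule inv_form_rank_one_update[OF adm_symm z y' less_imp_le[OF \<delta>0] vz0])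
  qed
  \<comment> \<open>As \<open>s\<close> is at least \<open>1 / 2\<close>, the product
    \<open>\<delta> * X = 1 / s\<close> is at most 2, so the Sherman-Morrison denominator is at most
    3. This is the source of \<open>X / 3\<close>.\<close>
  have "\<delta> * dot d v z \<le> \<delta> * X" using vz \<delta>0 by simp
  also have "\<delta> * X \<le> 2" using s X(2) by (simp add: \<delta> s_def field_simps)
  finally have "1 + \<delta> * dot d v z \<le> 3" by simp
  hence "\<delta> / 3 \<le> c"
    unfolding c_def using \<delta>0 vz0 by (intro divide_left_mono) (auto intro!: mult_pos_pos add_pos_nonneg)
  hence "s * ((\<delta> / 3) * X\<^sup>2) \<le> s * (c * X\<^sup>2)"
    using s by (intro mult_left_mono mult_right_mono) simp_all
  moreover have "s * ((\<delta> / 3) * X\<^sup>2) = X / 3"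
    using s X(2) by (simp add: \<delta> s_def power2_eq_square)
  moreover have "X\<^sup>2 \<le> (\<Sum>p<P. (dot d z (b p))\<^sup>2)"
    using a[of z] by (simp add: za)
  hence "s * (c * X\<^sup>2) \<le> s * (c * (\<Sum>p<P. (dot d z (b p))\<^sup>2))"
    using s \<open>\<delta> / 3 \<le> c\<close> \<delta>0 by (intro mult_left_mono) simp_all
  moreover have "s * (\<Sum>p<P. inv_form d (shifted ?M' w s) (b p))
      = s * (\<Sum>p<P. inv_form d (shifted M w s) (b p)) - s * (c * (\<Sum>p<P. (dot d z (b p))\<^sup>2))"
    by (simp add: eq sum_subtractf sum_distrib_left right_diff_distrib)
  ultimately have main: "s * (\<Sum>p<P. inv_form d (shifted ?M' w s) (b p))
      \<le> s * (\<Sum>p<P. inv_form d (shifted M w s) (b p)) - X / 3"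
    by linarith
  have "(\<Sum>l\<in>{..K} - {k}. scale l * (\<Sum>p<P. inv_form d (shifted ?M' w (scale l)) (b p)))
     \<le> (\<Sum>l\<in>{..K} - {k}. scale l * (\<Sum>p<P. inv_form d (shifted M w (scale l)) (b p)))"
    by (intro sum_mono mult_left_mono decr) (simp_all add: less_imp_le[OF scale_pos])
  thus "potential d P b K ?M' w \<le> potential d P b K M w - X / 3"
    using main k unfolding potential_def s_def by (simp add: sum.remove[of "{..K}" k])
qed

end

section \<open>Columns, resets and dyadic corrections\<close>

definition covers :: "nat \<Rightarrow> (nat \<Rightarrow> real) list \<Rightarrow> real \<Rightarrow> (nat \<Rightarrow> real) \<Rightarrow> bool" where
  "covers d C \<rho> a \<longleftrightarrow> (\<exists>r. (\<Sum>j<length C. (r j)\<^sup>2) \<le> \<rho>\<^sup>2 \<and> (\<forall>i<d. (\<Sum>j<length C. r j * (C ! j) i) = a i))"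

lemma sum_lessThan_add: "(\<Sum>j<m + n. f j) = (\<Sum>j<m. f j) + (\<Sum>j<n. f (m + j))" for f :: "nat \<Rightarrow> real"
  by (induction n) (simp_all add: add.assoc)

lemma covers_appendI1:
  assumes "covers d C \<rho> a" shows "covers d (C @ D) \<rho> a"
proof -
  obtain r where r: "(\<Sum>j<length C. (r j)\<^sup>2) \<le> \<rho>\<^sup>2" "\<And>i. i < d \<Longrightarrow> (\<Sum>j<length C. r j * (C ! j) i) = a i"
    using assms by (auto simp: covers_def)
  show ?thesis
    unfolding covers_def
    by (rule exI[of _ "\<lambda>j. if j < length C then r j else 0"]) (simp add: sum_lessThan_add nth_append r)
qed

lemma covers_appendI2:
  assumes "covers d D \<rho> a" shows "covers d (C @ D) \<rho> a"
proof -
  obtain r where r: "(\<Sum>j<length D. (r j)\<^sup>2) \<le> \<rho>\<^sup>2" "\<And>i. i < d \<Longrightarrow> (\<Sum>j<length D. r j * (D ! j) i) = a i"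
    using assms by (auto simp: covers_def)
  show ?thesis
    unfolding covers_def
    by (rule exI[of _ "\<lambda>j. if j < length C then 0 else r (j - length C)"]) (simp add: sum_lessThan_add nth_append r)
qed

lemma covers_cong: "covers d C \<rho> a \<Longrightarrow> (\<And>i. i < d \<Longrightarrow> a i = b i) \<Longrightarrow> covers d C \<rho> b"
  by (simp add: covers_def)

lemma covers_uminus:
  assumes "covers d C \<rho> a" shows "covers d C \<rho> (\<lambda>i. - a i)"
proof -
  obtain r where r: "(\<Sum>j<length C. (r j)\<^sup>2) \<le> \<rho>\<^sup>2" "\<And>i. i < d \<Longrightarrow> (\<Sum>j<length C. r j * (C ! j) i) = a i"
    using assms by (auto simp: covers_def)
  thus ?thesis
    unfolding covers_def by (intro exI[of _ "\<lambda>j. - r j"]) (simp add: sum_negf)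
qed

lemma covers_add:
  assumes "covers d C \<rho> a" "covers d C \<sigma> b" "0 \<le> \<rho>" "0 \<le> \<sigma>"
  shows "covers d C (\<rho> + \<sigma>) (\<lambda>i. a i + b i)"
proof -
  obtain r where r: "(\<Sum>j<length C. (r j)\<^sup>2) \<le> \<rho>\<^sup>2" "\<And>i. i < d \<Longrightarrow> (\<Sum>j<length C. r j * (C ! j) i) = a i"
    using assms by (auto simp: covers_def)
  obtain q where q: "(\<Sum>j<length C. (q j)\<^sup>2) \<le> \<sigma>\<^sup>2" "\<And>i. i < d \<Longrightarrow> (\<Sum>j<length C. q j * (C ! j) i) = b i"
    using assms by (auto simp: covers_def)
  have "sqrt (\<Sum>j<length C. (r j + q j)\<^sup>2) \<le> sqrt (\<Sum>j<length C. (r j)\<^sup>2) + sqrt (\<Sum>j<length C. (q j)\<^sup>2)"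
    using L2_set_triangle_ineq[of r q "{..<length C}"] by (simp add: L2_set_def)
  also have "\<dots> \<le> \<rho> + \<sigma>"
    using r(1) q(1) assms(3,4) by (intro add_mono real_le_lsqrt) (auto simp: sum_nonneg)
  finally have "(\<Sum>j<length C. (r j + q j)\<^sup>2) \<le> (\<rho> + \<sigma>)\<^sup>2"
    using assms(3,4) by (simp add: sqrt_le_D)
  thus ?thesis
    unfolding covers_def using r(2) q(2)
    by (intro exI[of _ "\<lambda>j. r j + q j"]) (simp add: distrib_right sum.distrib)
qed

lemma covers_zero: "covers d C 0 (\<lambda>i. 0)"
  unfolding covers_def by (intro exI[of _ "\<lambda>j. 0"]) simp

lemma covers_sum:
  assumes "\<And>h. h < n \<Longrightarrow> covers d C 1 (a h)"
  shows "covers d C (real n) (\<lambda>i. \<Sum>h<n. a h i)"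
  using assms
proof (induction n)
  case 0
  show ?case using covers_zero[of d C] by simp
next
  case (Suc n)
  show ?case
    using covers_add[OF Suc.IH[OF Suc.prems] Suc.prems[of n]] by (simp add: add.commute)
qed

text \<open>The half-open intervals from \<open>c (Suc h)\<close> to \<open>c h\<close> are disjoint
  and tile the interval from \<open>c l\<close> to \<open>c 0\<close>.\<close>

lemma telescope_indicator:
  fixes c :: "nat \<Rightarrow> nat" and x :: real
  assumes "\<And>h. c (Suc h) \<le> c h"
  shows "(\<Sum>h<l. if c (Suc h) \<le> t \<and> t < c h then x else 0) = (if c l \<le> t \<and> t < c 0 then x else 0)"
proof (induction l)
  case (Suc l)
  have "c (Suc l) \<le> c l" "c l \<le> c 0"
    using assms by (auto intro: lift_Suc_antimono_le)
  thus ?case using Suc by auto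
qed simp

text \<open>\<open>cols\<close> holds the columns of the process, \<open>out\<close> the append-only
  list that is really emitted. \<open>cuts\<close> is the history of cut positions, starting with
  zero: entry \<open>i\<close> of every column with index below the last cut at \<open>i\<close>
  counts as zero in \<open>gram\<close>. \<open>level S i\<close> counts the resets of coordinate
  \<open>i\<close>.\<close>

datatype state = State
  (cols: "(nat \<Rightarrow> real) list")
  (cuts: "(nat \<Rightarrow> nat) list")
  (level: "nat \<Rightarrow> nat")
  (out: "(nat \<Rightarrow> real) list")

definition cut :: "state \<Rightarrow> nat \<Rightarrow> nat" where
  "cut S = last (cuts S)"

definition resets :: "state \<Rightarrow> nat" where
  "resets S = length (cuts S) - 1"

definition entry :: "state \<Rightarrow> nat \<Rightarrow> nat \<Rightarrow> real" where
  "entry S t i = (if cut S i \<le> t then (cols S ! t) i else 0)"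

definition gram :: "state \<Rightarrow> nat \<Rightarrow> nat \<Rightarrow> real" where
  "gram S i j = (\<Sum>t<length (cols S). entry S t i * entry S t j)"

definition weight :: "state \<Rightarrow> nat \<Rightarrow> real" where
  "weight S i = 2 ^ level S i"

definition segment :: "state \<Rightarrow> (nat \<Rightarrow> nat) \<Rightarrow> (nat \<Rightarrow> nat) \<Rightarrow> nat \<Rightarrow> nat \<Rightarrow> real" where
  "segment S c c' t i = (if c i \<le> t \<and> t < c' i then (cols S ! t) i else 0)"

definition unit_vec :: "nat \<Rightarrow> nat \<Rightarrow> real" where
  "unit_vec k i = (if i = k then 1 else 0)"

definition init :: "nat \<Rightarrow> state" where
  "init d = State (map unit_vec [0..<d]) [\<lambda>_. 0] (\<lambda>_. 0) (map unit_vec [0..<d])"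

definition push :: "(nat \<Rightarrow> real) \<Rightarrow> state \<Rightarrow> state" where
  "push v S = State (cols S @ [v]) (cuts S) (level S) (out S @ [v])"

text \<open>\<open>length (cuts S)\<close> is the number of the reset being performed. For each
  power \<open>2 ^ h\<close> dividing it, with \<open>h < l\<close>, the parts of the columns
  removed by the last \<open>2 ^ h\<close> resets, the present one included, are emitted as columns
  of their own.\<close>

definition blocks :: "nat \<Rightarrow> nat \<Rightarrow> state \<Rightarrow> (nat \<Rightarrow> real) list" where
  "blocks l k S = concat (map (\<lambda>h. if 2 ^ h dvd length (cuts S)
     then map (segment S (cuts S ! (length (cuts S) - 2 ^ h)) ((cut S)(k := length (cols S)))) [0..<length (cols S)]
     else []) [0..<l])"

text \<open>The cut at \<open>k\<close> moves past all present columns. The appended unit vector has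
  exactly this cut as its index, so it is not truncated and restores the diagonal entry to
  1.\<close>

definition reset :: "nat \<Rightarrow> nat \<Rightarrow> state \<Rightarrow> state" where
  "reset l k S = State (cols S @ [unit_vec k]) (cuts S @ [(cut S)(k := length (cols S))])
     ((level S)(k := Suc (level S k))) (out S @ unit_vec k # blocks l k S)"

definition sumsq :: "(nat \<Rightarrow> real) list \<Rightarrow> nat \<Rightarrow> real" where
  "sumsq C i = (\<Sum>c\<leftarrow>C. (c i)\<^sup>2)"

lemma sumsq_append: "sumsq (C @ D) i = sumsq C i + sumsq D i"
  by (simp add: sumsq_def)

lemma sumsq_Nil: "sumsq [] i = 0"
  by (simp add: sumsq_def)

lemma sumsq_Cons: "sumsq (c # C) i = (c i)\<^sup>2 + sumsq C i"
  by (simp add: sumsq_def)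

lemma sumsq_nth: "sumsq C i = (\<Sum>t<length C. ((C ! t) i)\<^sup>2)"
  unfolding sumsq_def by (subst sum_list_sum_nth) (simp add: atLeast0LessThan)

definition cuts_ok :: "state \<Rightarrow> bool" where
  "cuts_ok S \<longleftrightarrow> cuts S \<noteq> [] \<and> cuts S ! 0 = (\<lambda>_. 0)
     \<and> (\<forall>n i. Suc n < length (cuts S) \<longrightarrow> (cuts S ! n) i \<le> (cuts S ! Suc n) i)
     \<and> (\<forall>n i. n < length (cuts S) \<longrightarrow> (cuts S ! n) i \<le> length (cols S))"

lemma cuts_ok_cut_le: "cuts_ok S \<Longrightarrow> cut S i \<le> length (cols S)"
  by (simp add: cuts_ok_def cut_def last_conv_nth)

lemma cuts_ok_push: "cuts_ok S \<Longrightarrow> cuts_ok (push v S)"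
  by (auto simp: cuts_ok_def push_def intro: le_SucI)

lemma cuts_ok_reset:
  assumes "cuts_ok S" shows "cuts_ok (reset l k S)"
proof -
  let ?c = "(cut S)(k := length (cols S))" and ?N = "length (cuts S)"
  have ne: "cuts S \<noteq> []" using assms by (simp add: cuts_ok_def)
  have c_le: "?c i \<le> length (cols S)" for i using cuts_ok_cut_le[OF assms] by simp
  have last: "(cuts S ! n) i \<le> ?c i" if "Suc n = ?N" for n i
  proof -
    have "n = ?N - 1" using that by simp
    thus ?thesis using cuts_ok_cut_le[OF assms, of i] ne by (auto simp: cut_def last_conv_nth)
  qed
  have S': "cuts (reset l k S) = cuts S @ [?c]" "length (cols (reset l k S)) = Suc (length (cols S))"
    by (simp_all add: reset_def)
  show ?thesis
    unfolding cuts_ok_def S'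
  proof (intro conjI allI impI)
    show "(cuts S @ [?c]) ! 0 = (\<lambda>_. 0)"
      using assms ne by (simp add: cuts_ok_def nth_append)
  next
    fix n i assume n: "Suc n < length (cuts S @ [?c])"
    show "((cuts S @ [?c]) ! n) i \<le> ((cuts S @ [?c]) ! Suc n) i"
    proof (cases "Suc n = ?N")
      case True
      hence "(cuts S @ [?c]) ! n = cuts S ! n" "(cuts S @ [?c]) ! Suc n = ?c" by (simp_all add: nth_append)
      thus ?thesis using last[OF True] by simp
    next
      case False
      hence "Suc n < ?N" using n by simp
      thus ?thesis using assms by (simp add: cuts_ok_def nth_append)
    qed
  next
    fix n i assume n: "n < length (cuts S @ [?c])"
    show "((cuts S @ [?c]) ! n) i \<le> Suc (length (cols S))"
    proof (cases "n = ?N")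
      case True
      hence "(cuts S @ [?c]) ! n = ?c" by simp
      thus ?thesis using c_le[of i] by simp
    next
      case False
      hence "n < ?N" using n by simp
      thus ?thesis using assms by (simp add: cuts_ok_def nth_append le_SucI)
    qed
  qed simp
qed

lemma cuts_mono:
  assumes "cuts_ok S" "m \<le> n" "n < length (cuts S)"
  shows "(cuts S ! m) i \<le> (cuts S ! n) i"
  using assms(2,3)
proof (induction n)
  case (Suc n)
  show ?case
  proof (cases "m = Suc n")
    case False
    hence "(cuts S ! m) i \<le> (cuts S ! n) i" using Suc by simp
    also have "\<dots> \<le> (cuts S ! Suc n) i" using assms(1) Suc.prems by (simp add: cuts_ok_def)
    finally show ?thesis .
  qed simp
qed simp

lemma gram_push:
  assumes "cuts_ok S"
  shows "gram (push v S) i j = gram S i j + v i * v j"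
proof -
  have "entry (push v S) t i = (if t < length (cols S) then entry S t i else v i)" if "t < Suc (length (cols S))" for t i
    using that cuts_ok_cut_le[OF assms, of i] by (auto simp: entry_def push_def cut_def nth_append less_Suc_eq)
  thus ?thesis by (simp add: gram_def push_def[of v S, THEN arg_cong[of _ _ cols]])
qed

lemma gram_reset:
  assumes "cuts_ok S"
  shows "gram (reset l k S) = decouple k 1 (gram S)"
proof (intro ext)
  fix i j
  have "entry (reset l k S) t i = (if t < length (cols S) then (if i = k then 0 else entry S t i) else unit_vec k i)"
    if "t < Suc (length (cols S))" for t i
    using that cuts_ok_cut_le[OF assms, of i]
    by (auto simp: entry_def reset_def cut_def nth_append less_Suc_eq unit_vec_def)
  thus "gram (reset l k S) i j = decouple k 1 (gram S) i j"
    by (simp add: gram_def reset_def[of l k S, THEN arg_cong[of _ _ cols]] decouple_def unit_vec_def)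
qed

lemma weight_push: "weight (push v S) = weight S"
  by (simp add: weight_def push_def fun_eq_iff)

lemma weight_reset: "weight (reset l k S) = (weight S)(k := 2 * weight S k)"
  by (simp add: weight_def reset_def fun_eq_iff)

text \<open>The segments of the columns cut off by the resets with numbers in a dyadic interval are put
  into the output.  They correct for the truncation of the columns, and every initial interval of resets
  is a union of at most \<open>l\<close> dyadic ones.\<close>

definition out_covers :: "nat \<Rightarrow> nat \<Rightarrow> state \<Rightarrow> bool" where
  "out_covers d l S \<longleftrightarrow>
     (\<forall>r. covers d (out S) (sqrt (\<Sum>t<length (cols S). (r t)\<^sup>2)) (\<lambda>i. \<Sum>t<length (cols S). r t * (cols S ! t) i)) \<and>
     (\<forall>r n h. (\<Sum>t<length (cols S). (r t)\<^sup>2) \<le> 1 \<longrightarrow> 0 < n \<longrightarrow> n < length (cuts S) \<longrightarrow> h < l \<longrightarrow> 2 ^ h dvd n \<longrightarrow>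
        covers d (out S) 1 (\<lambda>i. \<Sum>t<length (cols S). r t * segment S (cuts S ! (n - 2 ^ h)) (cuts S ! n) t i))"

text \<open>The blocks of size \<open>2 ^ h\<close> join without overlap into one segment, from
  position 0 to the cut after the last reset whose number is a multiple of \<open>2 ^ h\<close>. So
  each of the \<open>l\<close> levels repeats a column entry at most once.\<close>

definition out_bound :: "nat \<Rightarrow> state \<Rightarrow> bool" where
  "out_bound l S \<longleftrightarrow> (\<forall>i. sumsq (out S) i \<le> sumsq (cols S) i +
     (\<Sum>h<l. \<Sum>t<length (cols S). (segment S (\<lambda>_. 0) (cuts S ! (resets S div 2 ^ h * 2 ^ h)) t i)\<^sup>2))"

lemma covers_snoc:
  assumes "covers d C \<rho> a"
  shows "covers d (C @ [v]) (sqrt (\<rho>\<^sup>2 + x\<^sup>2)) (\<lambda>i. a i + x * v i)"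
proof -
  obtain r where r: "(\<Sum>j<length C. (r j)\<^sup>2) \<le> \<rho>\<^sup>2" "\<And>i. i < d \<Longrightarrow> (\<Sum>j<length C. r j * (C ! j) i) = a i"
    using assms by (auto simp: covers_def)
  show ?thesis
    unfolding covers_def
    by (rule exI[of _ "\<lambda>j. if j < length C then r j else x"]) (simp add: nth_append r)
qed

lemma covers_self: "covers d C (sqrt (\<Sum>t<length C. (r t)\<^sup>2)) (\<lambda>i. \<Sum>t<length C. r t * (C ! t) i)"
  unfolding covers_def by (intro exI[of _ r]) (simp add: sum_nonneg)

text \<open>The part common to \<open>push\<close> and \<open>reset\<close>. Segments between old
  cuts are unaffected, because old cuts do not reach past the old columns.\<close>

lemma out_covers_extend:
  assumes S: "cuts_ok S" "out_covers d l S"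
    and S': "cols S' = cols S @ [v]" "out S' = out S @ v # D"
  shows "covers d (out S') (sqrt (\<Sum>t<length (cols S'). (r t)\<^sup>2)) (\<lambda>i. \<Sum>t<length (cols S'). r t * (cols S' ! t) i)"
    and "(\<Sum>t<length (cols S'). (r t)\<^sup>2) \<le> 1 \<Longrightarrow> 0 < n \<Longrightarrow> n < length (cuts S) \<Longrightarrow> h < l \<Longrightarrow> 2 ^ h dvd n \<Longrightarrow>
      covers d (out S') 1 (\<lambda>i. \<Sum>t<length (cols S'). r t * segment S' (cuts S ! (n - 2 ^ h)) (cuts S ! n) t i)"
proof -
  have "covers d (out S) (sqrt (\<Sum>t<length (cols S). (r t)\<^sup>2)) (\<lambda>i. \<Sum>t<length (cols S). r t * (cols S ! t) i)"
    using S(2) by (simp add: out_covers_def)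
  from covers_appendI1[OF covers_snoc[OF this, of v "r (length (cols S))"], of D]
  show "covers d (out S') (sqrt (\<Sum>t<length (cols S'). (r t)\<^sup>2)) (\<lambda>i. \<Sum>t<length (cols S'). r t * (cols S' ! t) i)"
    by (simp add: S' nth_append sum_nonneg)
next
  assume r: "(\<Sum>t<length (cols S'). (r t)\<^sup>2) \<le> 1" and n: "0 < n" "n < length (cuts S)" "h < l" "2 ^ h dvd n"
  have "(\<Sum>t<length (cols S). (r t)\<^sup>2) \<le> 1"
  proof -
    have "(\<Sum>t<length (cols S). (r t)\<^sup>2) + (r (length (cols S)))\<^sup>2 \<le> 1" using r by (simp add: S')
    thus ?thesis by (smt (verit) zero_le_power2)
  qed
  hence "covers d (out S) 1 (\<lambda>i. \<Sum>t<length (cols S). r t * segment S (cuts S ! (n - 2 ^ h)) (cuts S ! n) t i)"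
    using S(2) n by (simp add: out_covers_def)
  hence "covers d (out S') 1 (\<lambda>i. \<Sum>t<length (cols S). r t * segment S (cuts S ! (n - 2 ^ h)) (cuts S ! n) t i)"
    unfolding S' by (rule covers_appendI1)
  moreover have "(\<Sum>t<length (cols S'). r t * segment S' (cuts S ! (n - 2 ^ h)) (cuts S ! n) t i)
     = (\<Sum>t<length (cols S). r t * segment S (cuts S ! (n - 2 ^ h)) (cuts S ! n) t i)" for i
  proof -
    have "(cuts S ! n) i \<le> length (cols S)"
      using S(1) n by (simp add: cuts_ok_def)
    thus ?thesis
      by (auto simp: S' segment_def nth_append intro!: sum.cong)
  qed
  ultimately show "covers d (out S') 1 (\<lambda>i. \<Sum>t<length (cols S'). r t * segment S' (cuts S ! (n - 2 ^ h)) (cuts S ! n) t i)"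
    by simp
qed

lemma out_covers_push:
  assumes "cuts_ok S" "out_covers d l S"
  shows "out_covers d l (push v S)"
  using out_covers_extend[OF assms, of "push v S" v "[]"]
  unfolding out_covers_def by (simp add: push_def)

lemma out_covers_reset:
  assumes S: "cuts_ok S" "out_covers d l S"
  shows "out_covers d l (reset l k S)"
proof -
  let ?S = "reset l k S" let ?c = "(cut S)(k := length (cols S))" let ?N = "length (cuts S)"
  have S': "cols ?S = cols S @ [unit_vec k]" "out ?S = out S @ unit_vec k # blocks l k S" "cuts ?S = cuts S @ [?c]"
    by (simp_all add: reset_def)
  \<comment> \<open>The new dyadic intervals are those that end at the present reset;
    \<open>blocks\<close> emits their segments.\<close>
  have new: "covers d (out ?S) 1 (\<lambda>i. \<Sum>t<length (cols ?S). r t * segment ?S (cuts ?S ! (?N - 2 ^ h)) (cuts ?S ! ?N) t i)"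
    if r: "(\<Sum>t<length (cols ?S). (r t)\<^sup>2) \<le> 1" and h: "h < l" "2 ^ h dvd ?N" for r h
  proof -
    let ?B = "map (segment S (cuts S ! (?N - 2 ^ h)) ?c) [0..<length (cols S)]"
    have N: "0 < ?N" using S(1) by (simp add: cuts_ok_def)
    have "?B \<in> set (map (\<lambda>h. if 2 ^ h dvd ?N then map (segment S (cuts S ! (?N - 2 ^ h)) ?c) [0..<length (cols S)] else []) [0..<l])"
      using h by (force simp: image_iff)
    from split_list[OF this] obtain C D where
      "map (\<lambda>h. if 2 ^ h dvd ?N then map (segment S (cuts S ! (?N - 2 ^ h)) ?c) [0..<length (cols S)] else []) [0..<l]
        = C @ ?B # D" by blast
    hence out: "out ?S = (out S @ unit_vec k # concat C) @ ?B @ concat D"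
      unfolding S' blocks_def by simp
    have "(\<Sum>t<length (cols S). (r t)\<^sup>2) \<le> 1"
    proof -
    have "(\<Sum>t<length (cols S). (r t)\<^sup>2) + (r (length (cols S)))\<^sup>2 \<le> 1" using r by (simp add: S')
    thus ?thesis by (smt (verit) zero_le_power2)
  qed
    hence "covers d ?B 1 (\<lambda>i. \<Sum>t<length (cols S). r t * segment S (cuts S ! (?N - 2 ^ h)) ?c t i)"
      unfolding covers_def by (intro exI[of _ r]) simp
    hence "covers d (out ?S) 1 (\<lambda>i. \<Sum>t<length (cols S). r t * segment S (cuts S ! (?N - 2 ^ h)) ?c t i)"
      unfolding out by (intro covers_appendI1 covers_appendI2)
    moreover have "(\<Sum>t<length (cols ?S). r t * segment ?S (cuts ?S ! (?N - 2 ^ h)) (cuts ?S ! ?N) t i)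
       = (\<Sum>t<length (cols S). r t * segment S (cuts S ! (?N - 2 ^ h)) ?c t i)" for i
      using cuts_ok_cut_le[OF S(1), of i] N
      by (auto simp: S' segment_def nth_append not_less intro!: sum.cong)
    ultimately show ?thesis by simp
  qed
  show ?thesis
    unfolding out_covers_def
  proof (intro conjI allI impI)
    fix r :: "nat \<Rightarrow> real" and n h
    assume *: "(\<Sum>t<length (cols ?S). (r t)\<^sup>2) \<le> 1" "0 < n" "n < length (cuts ?S)" "h < l" "2 ^ h dvd n"
    show "covers d (out ?S) 1 (\<lambda>i. \<Sum>t<length (cols ?S). r t * segment ?S (cuts ?S ! (n - 2 ^ h)) (cuts ?S ! n) t i)"
    proof (cases "n = ?N")
      case True
      thus ?thesis using new[OF *(1,4)] *(5) by simp
    next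
      case False
      hence n: "n < ?N" using * by (simp add: S')
      thus ?thesis using out_covers_extend(2)[OF S S'(1,2) *(1,2) n *(4,5)]
        by (simp add: S'(3) nth_append less_imp_diff_less)
    qed
  qed (rule out_covers_extend(1)[OF S S'(1,2)])
qed

lemma sum_segment_extend:
  assumes "cols S' = cols S @ [v]" "\<And>i. c' i \<le> length (cols S)"
  shows "(\<Sum>t<length (cols S'). (segment S' c c' t i)\<^sup>2) = (\<Sum>t<length (cols S). (segment S c c' t i)\<^sup>2)"
proof -
  have "segment S' c c' t i = segment S c c' t i" if "t < length (cols S)" for t
    using that by (simp add: segment_def assms(1) nth_append)
  moreover have "segment S' c c' (length (cols S)) i = 0"
    using assms(2)[of i] by (simp add: segment_def)
  ultimately show ?thesis by (simp add: assms(1))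
qed

lemma sum_segment_join:
  assumes "c i \<le> c' i" "c' i \<le> c'' i"
  shows "(\<Sum>t<n. (segment S c c' t i)\<^sup>2) + (\<Sum>t<n. (segment S c' c'' t i)\<^sup>2) = (\<Sum>t<n. (segment S c c'' t i)\<^sup>2)"
proof -
  have "(segment S c c' t i)\<^sup>2 + (segment S c' c'' t i)\<^sup>2 = (segment S c c'' t i)\<^sup>2" for t
    using assms by (simp add: segment_def)
  thus ?thesis by (simp flip: sum.distrib)
qed

lemma resets_push: "resets (push v S) = resets S"
  by (simp add: resets_def push_def)

lemma resets_reset: "cuts S \<noteq> [] \<Longrightarrow> resets (reset l k S) = Suc (resets S)"
  by (cases "cuts S") (simp_all add: resets_def reset_def)

lemma out_bound_push:
  assumes "cuts_ok S" "out_bound l S"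
  shows "out_bound l (push v S)"
proof -
  have "(\<Sum>t<length (cols (push v S)). (segment (push v S) (\<lambda>_. 0) (cuts S ! (resets S div 2 ^ h * 2 ^ h)) t i)\<^sup>2)
      = (\<Sum>t<length (cols S). (segment S (\<lambda>_. 0) (cuts S ! (resets S div 2 ^ h * 2 ^ h)) t i)\<^sup>2)" for h i
  proof (rule sum_segment_extend)
    have "resets S div 2 ^ h * 2 ^ h \<le> resets S" by simp
    hence "resets S div 2 ^ h * 2 ^ h < length (cuts S)"
      using assms(1) unfolding cuts_ok_def resets_def by (metis diff_less le_less_trans length_greater_0_conv zero_less_one)
    thus "(cuts S ! (resets S div 2 ^ h * 2 ^ h)) i \<le> length (cols S)" for i
      using assms(1) by (simp add: cuts_ok_def)
  qed (simp add: push_def)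
  moreover have "out (push v S) = out S @ [v]" "cols (push v S) = cols S @ [v]" "cuts (push v S) = cuts S"
    by (simp_all add: push_def)
  ultimately show ?thesis
    using assms(2) by (simp add: out_bound_def resets_push sumsq_append sumsq_Cons)
qed

text \<open>Rounding down to a multiple of \<open>2 ^ h\<close> moves only at the multiples
  themselves, and then by one whole block. This matches the divisibility test in
  \<open>blocks\<close>.\<close>

lemma div_Suc_pow:
  fixes n :: nat
  shows "Suc n div 2 ^ h * 2 ^ h = (if 2 ^ h dvd Suc n then Suc n else n div 2 ^ h * 2 ^ h)"
    and "2 ^ h dvd Suc n \<Longrightarrow> n div 2 ^ h * 2 ^ h = Suc n - 2 ^ h"
proof -
  show *: "n div 2 ^ h * 2 ^ h = Suc n - 2 ^ h" if dvd: "2 ^ h dvd Suc n"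
  proof -
    obtain q where q: "Suc n = 2 ^ h * q" using dvd by (rule dvdE)
    then obtain p where p: "q = Suc p" by (cases q) auto
    have n: "Suc n = 2 ^ h * p + 2 ^ h" using q p by simp
    have "n div 2 ^ h = p"
    proof (rule div_nat_eqI)
      show "2 ^ h * p \<le> n" using n one_le_power[of "2::nat" h] by linarith
      show "n < 2 ^ h * Suc p" using n by simp
    qed
    thus ?thesis using n by (simp add: mult.commute)
  qed
  show "Suc n div 2 ^ h * 2 ^ h = (if 2 ^ h dvd Suc n then Suc n else n div 2 ^ h * 2 ^ h)"
  proof (cases "2 ^ h dvd Suc n")
    case False
    hence "Suc n mod 2 ^ h \<noteq> 0" by (simp add: dvd_eq_mod_eq_0)
    thus ?thesis using False by (simp add: div_Suc)
  qed simp
qed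

lemma sumsq_blocks:
  "sumsq (blocks l k S) i = (\<Sum>h<l. if 2 ^ h dvd length (cuts S)
     then \<Sum>t<length (cols S). (segment S (cuts S ! (length (cuts S) - 2 ^ h)) ((cut S)(k := length (cols S))) t i)\<^sup>2
     else 0)"
proof -
  have "sumsq (concat xs) i = (\<Sum>x\<leftarrow>xs. sumsq x i)" for xs
    by (induction xs) (simp_all add: sumsq_append, simp add: sumsq_def)
  moreover have "sumsq (map f [0..<n]) i = (\<Sum>t<n. (f t i)\<^sup>2)" for f n
    by (simp add: sumsq_nth)
  ultimately show ?thesis
    unfolding blocks_def
    by (simp add: o_def interv_sum_list_conv_sum_set_nat atLeast0LessThan if_distrib[of "\<lambda>x. sumsq x i"] sumsq_def[of "[]"] cong: if_cong)
qed

lemma out_bound_reset: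
  assumes S: "cuts_ok S" "out_bound l S"
  shows "out_bound l (reset l k S)"
proof -
  let ?S = "reset l k S" let ?c = "(cut S)(k := length (cols S))" let ?N = "length (cuts S)"
  have S': "cols ?S = cols S @ [unit_vec k]" "out ?S = out S @ unit_vec k # blocks l k S" "cuts ?S = cuts S @ [?c]"
    by (simp_all add: reset_def)
  have N: "?N = Suc (resets S)" "cuts S \<noteq> []" using S(1) by (auto simp: cuts_ok_def resets_def)
  have c_le: "?c i \<le> length (cols S)" for i using cuts_ok_cut_le[OF S(1)] by simp
  define F where "F h i = (\<Sum>t<length (cols S). (segment S (\<lambda>_. 0) (cuts S ! (resets S div 2 ^ h * 2 ^ h)) t i)\<^sup>2)" for h i
  define G where "G h i = (if 2 ^ h dvd ?N
     then \<Sum>t<length (cols S). (segment S (cuts S ! (?N - 2 ^ h)) ?c t i)\<^sup>2 else 0)" for h i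
  have "(\<Sum>t<length (cols ?S). (segment ?S (\<lambda>_. 0) (cuts ?S ! (resets ?S div 2 ^ h * 2 ^ h)) t i)\<^sup>2) = F h i + G h i" for h i
  proof -
    define n where "n = resets S div 2 ^ h * 2 ^ h"
    have "n \<le> resets S" by (simp add: n_def)
    hence n: "n < ?N" by (simp add: N)
    have n_le: "(cuts S ! n) i \<le> length (cols S)" for i
      using S(1) n by (simp add: cuts_ok_def)
    show ?thesis
    proof (cases "2 ^ h dvd ?N")
      case True
      have n': "n = ?N - 2 ^ h" using div_Suc_pow(2)[of h "resets S"] True by (simp add: N n_def)
      have "cuts ?S ! (resets ?S div 2 ^ h * 2 ^ h) = ?c"
        using True nth_append_length[of "cuts S" ?c] by (simp add: resets_reset[OF N(2)] div_Suc_pow(1) N(1) S')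
      moreover have "(\<Sum>t<length (cols ?S). (segment ?S (\<lambda>_. 0) ?c t i)\<^sup>2) = (\<Sum>t<length (cols S). (segment S (\<lambda>_. 0) ?c t i)\<^sup>2)"
        by (rule sum_segment_extend[OF S'(1) c_le])
      moreover have "(cuts S ! n) i \<le> ?c i"
        using cuts_mono[OF S(1), of n "?N - 1" i] n n_le[of i] N(2) by (auto simp: cut_def last_conv_nth)
      hence "F h i + G h i = (\<Sum>t<length (cols S). (segment S (\<lambda>_. 0) ?c t i)\<^sup>2)"
        using True sum_segment_join[of "\<lambda>_. 0" i "cuts S ! n" ?c] by (simp add: F_def G_def n_def[symmetric] n')
      ultimately show ?thesis by simp
    next
      case False
      have "cuts ?S ! (resets ?S div 2 ^ h * 2 ^ h) = cuts S ! n"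
        using False n by (simp add: resets_reset[OF N(2)] div_Suc_pow(1) N(1) S' nth_append n_def)
      thus ?thesis
        using False sum_segment_extend[OF S'(1) n_le] by (simp add: F_def G_def n_def)
    qed
  qed
  hence "(\<Sum>h<l. \<Sum>t<length (cols ?S). (segment ?S (\<lambda>_. 0) (cuts ?S ! (resets ?S div 2 ^ h * 2 ^ h)) t i)\<^sup>2)
     = (\<Sum>h<l. F h i) + (\<Sum>h<l. G h i)" for i
    by (simp add: sum.distrib)
  moreover have "sumsq (blocks l k S) i = (\<Sum>h<l. G h i)" for i
    unfolding sumsq_blocks G_def ..
  moreover have "sumsq (out S) i \<le> sumsq (cols S) i + (\<Sum>h<l. F h i)" for i
    using S(2) by (simp add: out_bound_def F_def)
  ultimately show ?thesis
    unfolding out_bound_def S'(1,2) by (simp add: sumsq_append sumsq_Cons sumsq_Nil)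
qed

lemma out_bound_le:
  assumes "out_bound l S"
  shows "sumsq (out S) i \<le> (real l + 1) * sumsq (cols S) i"
proof -
  have "(\<Sum>t<length (cols S). (segment S (\<lambda>_. 0) c t i)\<^sup>2) \<le> sumsq (cols S) i" for c
    unfolding sumsq_nth by (intro sum_mono) (simp add: segment_def)
  hence "(\<Sum>h<l. \<Sum>t<length (cols S). (segment S (\<lambda>_. 0) (cuts S ! (resets S div 2 ^ h * 2 ^ h)) t i)\<^sup>2)
     \<le> (\<Sum>h<l. sumsq (cols S) i)"
    by (intro sum_mono)
  thus ?thesis
    using assms[unfolded out_bound_def, rule_format, of i] by (simp add: distrib_right)
qed

section \<open>Invariants of the covering process\<close>

text \<open>The potential allows at most \<open>24 * (l + 4)\<^sup>2\<close> rank one updates per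
  unit of weight. The threshold is twice that, which lets the argument in
  \<open>potential_inv_bounds\<close> close.\<close>

definition threshold :: "nat \<Rightarrow> nat" where
  "threshold l = 48 * (l + 4)\<^sup>2"

definition heavy :: "nat \<Rightarrow> nat \<Rightarrow> state \<Rightarrow> nat \<Rightarrow> bool" where
  "heavy d l S k \<longleftrightarrow> k < d \<and> real (threshold l) < gram S k k - 1"

text \<open>A witness is a scale together with a solution at that scale. The scales \<open>0\<close>
  to \<open>l + 3\<close> are \<open>l + 4\<close> in number, which fixes the cutoff used in
  \<open>inv_form_le_1\<close>.\<close>

definition strong :: "nat \<Rightarrow> nat \<Rightarrow> (nat \<Rightarrow> real) \<Rightarrow> state \<Rightarrow> nat \<times> (nat \<Rightarrow> real) \<Rightarrow> bool" where
  "strong d l a S = (\<lambda>(k, y). k \<le> l + 3 \<and> solves d (shifted (gram S) (weight S) (scale k)) a y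
     \<and> 1 / (4 * (real l + 4)) < strength d (weight S) (scale k) y)"

text \<open>The vector \<open>v\<close> of \<open>potential_step\<close> times the square root of
  \<open>\<delta>\<close>, so that \<open>push\<close> adds the rank one matrix considered there to
  the Gram matrix.\<close>

definition step_vec :: "nat \<Rightarrow> state \<Rightarrow> nat \<times> (nat \<Rightarrow> real) \<Rightarrow> nat \<Rightarrow> real" where
  "step_vec d S = (\<lambda>(k, y) i. sqrt (1 / (scale k * strength d (weight S) (scale k) y)) * (scale k * y i / weight S i))"

text \<open>Resets take precedence: a push happens only when no coordinate is heavy, which keeps
  every diagonal entry below \<open>threshold l + 2\<close>, up to equality.\<close>

definition tick :: "nat \<Rightarrow> nat \<Rightarrow> (nat \<Rightarrow> real) \<Rightarrow> state \<Rightarrow> state" where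
  "tick d l a S = (if \<exists>k. heavy d l S k then reset l (SOME k. heavy d l S k) S
     else if \<exists>q. strong d l a S q then push (step_vec d S (SOME q. strong d l a S q)) S
     else S)"

text \<open>The full columns contain more than the Gram matrix shows: every reset of
  \<open>i\<close> hides at most \<open>threshold l + 2\<close> of the squared entries, whence the
  term with \<open>level S i\<close>.\<close>

definition structure_inv :: "nat \<Rightarrow> nat \<Rightarrow> state \<Rightarrow> bool" where
  "structure_inv d l S \<longleftrightarrow> cuts_ok S \<and> out_covers d l S \<and> out_bound l S
     \<and> (\<Sum>i<d. level S i) = resets S
     \<and> admissible d (gram S) (weight S)
     \<and> (\<forall>i<d. sumsq (cols S) i \<le> real (level S i) * (real (threshold l) + 2) + gram S i i)
     \<and> (\<forall>i<d. gram S i i \<le> real (threshold l) + 2)"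

text \<open>\<open>n\<close> counts the rank one updates; each of them adds \<open>1\<close> to the weighted trace and decreases the
  potential by a constant multiple of \<open>1 / l\<close>.\<close>

definition potential_inv :: "nat \<Rightarrow> nat \<Rightarrow> nat \<Rightarrow> (nat \<Rightarrow> nat \<Rightarrow> real) \<Rightarrow> nat \<Rightarrow> state \<Rightarrow> bool" where
  "potential_inv d l P b n S \<longleftrightarrow>
     real n / (12 * (real l + 4)) + potential d P b (l + 3) (gram S) (weight S)
       \<le> (real l + 4) * (\<Sum>i<d. 2 * weight S i - 1)
     \<and> (\<Sum>i<d. weight S i * (gram S i i - 1) + real (threshold l) * (weight S i - 1)) \<le> real n"

definition comparator :: "nat \<Rightarrow> nat \<Rightarrow> (nat \<Rightarrow> nat \<Rightarrow> real) \<Rightarrow> bool" where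
  "comparator d P b \<longleftrightarrow> (\<forall>i<d. (\<Sum>p<P. (b p i)\<^sup>2) \<le> 1)"

text \<open>In the Loewner order: the rank one matrix of \<open>a\<close> is at most the sum of
  those of the \<open>b p\<close>, whose diagonal \<open>comparator\<close> bounds by 1.\<close>

definition dominated :: "nat \<Rightarrow> nat \<Rightarrow> (nat \<Rightarrow> nat \<Rightarrow> real) \<Rightarrow> (nat \<Rightarrow> real) \<Rightarrow> bool" where
  "dominated d P b a \<longleftrightarrow> (\<forall>u. (dot d u a)\<^sup>2 \<le> (\<Sum>p<P. (dot d u (b p))\<^sup>2))"

lemma gram_init: "i < d \<Longrightarrow> j < d \<Longrightarrow> gram (init d) i j = (if i = j then 1 else 0)"
proof -
  assume i: "i < d" "j < d"
  have "gram (init d) i j = (\<Sum>t<d. if t = i then (if i = j then 1 else 0) else 0)"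
    unfolding gram_def by (intro sum.cong) (auto simp: init_def entry_def cut_def unit_vec_def)
  thus ?thesis using i by simp
qed

lemma weight_init: "weight (init d) i = 1"
  by (simp add: weight_def init_def)

lemma mv_gram_init: "i < d \<Longrightarrow> mv d (gram (init d)) u i = u i"
  by (simp add: mv_def gram_init if_distrib[of "\<lambda>x. x * _"] cong: if_cong)

lemma solves_init: "0 \<le> s \<Longrightarrow> solves d (shifted (gram (init d)) (weight (init d)) s) x (\<lambda>i. x i / (1 + s))"
proof -
  assume s: "0 \<le> s"
  have "x i / (1 + s) + s * (x i / (1 + s)) = x i" for i
    using s distrib_right[of 1 s "x i / (1 + s)"] by (simp del: distrib_right)
  thus ?thesis
    by (simp add: solves_def mv_shifted mv_gram_init weight_init)
qed

lemma admissible_init: "admissible d (gram (init d)) (weight (init d))"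
  unfolding admissible_def
proof (intro conjI allI impI)
  show "symm d (gram (init d))" by (simp add: symm_def gram_init)
  show "dot d u u \<le> dot d u (mv d (gram (init d)) u)" for u
    by (simp add: mv_gram_init cong: dot_cong)
  show "\<exists>y. solves d (shifted (gram (init d)) (weight (init d)) s) x y" if "0 \<le> s" for s x
    using solves_init[OF that] by blast
qed (simp add: weight_init)

lemma structure_inv_init: "structure_inv d l (init d)"
  unfolding structure_inv_def
proof (intro conjI allI impI)
  show "cuts_ok (init d)" by (simp add: cuts_ok_def init_def)
  show "out_covers d l (init d)"
    using covers_self[of d "map unit_vec [0..<d]"] by (simp add: out_covers_def init_def)
  show "out_bound l (init d)" by (simp add: out_bound_def init_def sum_nonneg)
  show "admissible d (gram (init d)) (weight (init d))" by (rule admissible_init)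
  fix i assume i: "i < d"
  have "sumsq (cols (init d)) i = (\<Sum>t<d. if t = i then 1 else 0)"
    unfolding sumsq_nth by (intro sum.cong) (auto simp: init_def unit_vec_def)
  thus "sumsq (cols (init d)) i \<le> real (level (init d) i) * (real (threshold l) + 2) + gram (init d) i i"
    using i by (simp add: gram_init)
  show "gram (init d) i i \<le> real (threshold l) + 2" using i by (simp add: gram_init)
qed (simp add: init_def resets_def)

text \<open>Initially the matrix is the identity and all weights are 1, so each of the
  \<open>l + 4\<close> scales contributes \<open>s / (1 + s)\<close> times the trace of the
  comparator, and this trace is at most \<open>d\<close>.\<close>

lemma potential_inv_init:
  assumes "comparator d P b"
  shows "potential_inv d l P b 0 (init d)"
proof -
  have "scale k * (\<Sum>p<P. inv_form d (shifted (gram (init d)) (weight (init d)) (scale k)) (b p)) \<le> real d" for k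
  proof -
    have s: "0 < scale k" by (rule scale_pos)
    have eq: "inv_form d (shifted (gram (init d)) (weight (init d)) (scale k)) x = (\<Sum>i<d. (x i)\<^sup>2) / (1 + scale k)" for x
      using inv_form_eq[OF adm_symm[OF admissible_init] solves_init, of "scale k" d x] s
      by (simp add: dot_def power2_eq_square sum_divide_distrib)
    have "(\<Sum>p<P. \<Sum>i<d. (b p i)\<^sup>2) = (\<Sum>i<d. \<Sum>p<P. (b p i)\<^sup>2)" by (rule sum.swap)
    also have "\<dots> \<le> (\<Sum>i<d. 1)" using assms by (intro sum_mono) (simp add: comparator_def)
    finally have S: "(\<Sum>p<P. \<Sum>i<d. (b p i)\<^sup>2) \<le> real d" by simp
    have "scale k * (\<Sum>p<P. inv_form d (shifted (gram (init d)) (weight (init d)) (scale k)) (b p))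
        = scale k / (1 + scale k) * (\<Sum>p<P. \<Sum>i<d. (b p i)\<^sup>2)"
      by (simp add: eq flip: sum_divide_distrib)
    also have "\<dots> \<le> 1 * real d"
      using s S by (intro mult_mono) (simp_all add: sum_nonneg)
    finally show ?thesis by simp
  qed
  hence "potential d P b (l + 3) (gram (init d)) (weight (init d)) \<le> (\<Sum>k\<le>l + 3. real d)"
    unfolding potential_def by (intro sum_mono)
  thus ?thesis by (simp add: potential_inv_def gram_init weight_init algebra_simps)
qed

section \<open>Preservation of the invariants under resets and pushes\<close>

lemma structure_inv_reset:
  assumes S: "structure_inv d l S" and k: "heavy d l S k"
  shows "structure_inv d l (reset l k S)"
proof -
  have kd: "k < d" using k by (simp add: heavy_def)
  have ok: "cuts_ok S" using S by (simp add: structure_inv_def)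
  have "(\<Sum>i<d. level (reset l k S) i) = (\<Sum>i<d. level S i + (if i = k then 1 else 0))"
    by (intro sum.cong) (auto simp: reset_def)
  also have "\<dots> = resets (reset l k S)"
    using S ok kd by (simp add: sum.distrib structure_inv_def resets_reset cuts_ok_def)
  finally have "(\<Sum>i<d. level (reset l k S) i) = resets (reset l k S)" .
  moreover have "sumsq (cols (reset l k S)) i \<le> real (level (reset l k S) i) * (real (threshold l) + 2) + gram (reset l k S) i i"
    if "i < d" for i
  proof (cases "i = k")
    case True
    have "sumsq (cols S) k + 1 \<le> real (level S k) * (real (threshold l) + 2) + gram S k k + 1"
      using S kd by (simp add: structure_inv_def)
    also have "\<dots> \<le> real (Suc (level S k)) * (real (threshold l) + 2) + 1"
    proof -
      have "gram S k k \<le> real (threshold l) + 2" using S kd unfolding structure_inv_def by blast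
      thus ?thesis by (simp add: distrib_right)
    qed
    finally show ?thesis
      using True by (simp add: gram_reset[OF ok] decouple_def) (simp add: reset_def sumsq_append sumsq_Cons sumsq_Nil unit_vec_def)
  next
    case False
    thus ?thesis
      using S that by (simp add: gram_reset[OF ok] decouple_def) (simp add: structure_inv_def reset_def sumsq_append sumsq_Cons sumsq_Nil unit_vec_def)
  qed
  ultimately show ?thesis
    using S cuts_ok_reset[OF ok] out_covers_reset[OF ok] out_bound_reset[OF ok] admissible_decouple[OF _ kd]
    by (simp add: structure_inv_def gram_reset[OF ok] weight_reset) (simp add: decouple_def)
qed

lemma sum_update:
  fixes f g :: "nat \<Rightarrow> real"
  assumes "k < d" "\<And>i. i < d \<Longrightarrow> i \<noteq> k \<Longrightarrow> f i = g i"
  shows "(\<Sum>i<d. f i) = (\<Sum>i<d. g i) + (f k - g k)"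
proof -
  have "(\<Sum>i\<in>{..<d} - {k}. f i) = (\<Sum>i\<in>{..<d} - {k}. g i)"
    using assms(2) by (intro sum.cong) auto
  thus ?thesis using assms(1) by (simp add: sum.remove[of "{..<d}" k])
qed

text \<open>Doubling the weight of \<open>k\<close> raises \<open>2 * weight S k - 1\<close> by
  \<open>2 * weight S k\<close>, which pays for the rise of the potential. In the second sum
  \<open>weight S k * (gram S k k - 1)\<close> is traded for
  \<open>threshold l * weight S k\<close>, which is smaller because \<open>k\<close> is
  heavy.\<close>

lemma potential_inv_reset:
  assumes S: "structure_inv d l S" "potential_inv d l P b n S" and k: "heavy d l S k" and b: "comparator d P b"
  shows "potential_inv d l P b n (reset l k S)"
proof -
  have kd: "k < d" and hv: "real (threshold l) < gram S k k - 1" using k by (simp_all add: heavy_def)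
  have ok: "cuts_ok S" and adm: "admissible d (gram S) (weight S)" using S by (simp_all add: structure_inv_def)
  have "potential d P b (l + 3) (gram (reset l k S)) (weight (reset l k S))
      \<le> potential d P b (l + 3) (gram S) (weight S) + (real l + 4) * (2 * weight S k)"
    using potential_decouple[OF adm kd, where P = P and b = b and K = "l + 3"] b kd
    by (simp add: gram_reset[OF ok] weight_reset comparator_def algebra_simps)
  moreover have "(\<Sum>i<d. 2 * weight (reset l k S) i - 1) = (\<Sum>i<d. 2 * weight S i - 1) + 2 * weight S k"
    using sum_update[of k d "\<lambda>i. 2 * weight (reset l k S) i - 1" "\<lambda>i. 2 * weight S i - 1"] kd
    by (simp add: weight_reset)
  hence "(real l + 4) * (\<Sum>i<d. 2 * weight (reset l k S) i - 1)
      = (real l + 4) * (\<Sum>i<d. 2 * weight S i - 1) + (real l + 4) * (2 * weight S k)"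
    by (simp only: distrib_left)
  moreover have "(\<Sum>i<d. weight (reset l k S) i * (gram (reset l k S) i i - 1) + real (threshold l) * (weight (reset l k S) i - 1))
      = (\<Sum>i<d. weight S i * (gram S i i - 1) + real (threshold l) * (weight S i - 1))
        + (real (threshold l) * weight S k - weight S k * (gram S k k - 1))"
    using sum_update[of k d "\<lambda>i. weight (reset l k S) i * (gram (reset l k S) i i - 1) + real (threshold l) * (weight (reset l k S) i - 1)"
        "\<lambda>i. weight S i * (gram S i i - 1) + real (threshold l) * (weight S i - 1)"] kd
    by (simp add: weight_reset gram_reset[OF ok] decouple_def algebra_simps)
  moreover have "weight S k * real (threshold l) \<le> weight S k * (gram S k k - 1)"
    using hv by (intro mult_left_mono) (simp_all add: weight_def)
  ultimately show ?thesis
    using S(2) unfolding potential_inv_def by (simp add: mult.commute)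
qed

lemma strong_push:
  assumes S: "structure_inv d l S" and q: "strong d l a S q"
  obtains k y X v \<delta> where "q = (k, y)" "k \<le> l + 3" "solves d (shifted (gram S) (weight S) (scale k)) a y"
    "X = strength d (weight S) (scale k) y" "1 / (4 * (real l + 4)) < X"
    "v = (\<lambda>i. scale k * y i / weight S i)" "\<delta> = 1 / (scale k * X)"
    "gram (push (step_vec d S q) S) = (\<lambda>i j. gram S i j + \<delta> * (v i * v j))"
    "\<forall>i. (step_vec d S q i)\<^sup>2 = \<delta> * (v i * v i)" "0 < \<delta>" "0 < X"
proof -
  obtain k y where ky: "q = (k, y)" by force
  define X where "X = strength d (weight S) (scale k) y"
  define v where "v = (\<lambda>i. scale k * y i / weight S i)"
  define \<delta> where "\<delta> = 1 / (scale k * X)"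
  have *: "k \<le> l + 3" "solves d (shifted (gram S) (weight S) (scale k)) a y" "1 / (4 * (real l + 4)) < X"
    using q by (simp_all add: strong_def ky X_def)
  have X: "0 < X" using *(3) by (smt (verit) divide_pos_pos of_nat_0_le_iff)
  hence \<delta>: "0 < \<delta>" by (simp add: \<delta>_def scale_pos)
  have sv: "step_vec d S q = (\<lambda>i. sqrt \<delta> * v i)"
    by (simp add: step_vec_def ky \<delta>_def v_def X_def)
  have sq: "sqrt \<delta> * x * (sqrt \<delta> * y) = \<delta> * (x * y)" for x y
    using \<delta> by (simp add: algebra_simps abs_of_pos)
  have ok: "cuts_ok S" using S by (simp add: structure_inv_def)
  show ?thesis
    using sq \<delta> by (intro that[OF ky *(1,2) X_def *(3) v_def \<delta>_def _ _ \<delta> X])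
      (simp_all add: sv gram_push[OF ok] fun_eq_iff power2_eq_square)
qed

lemma structure_inv_push:
  assumes S: "structure_inv d l S" and q: "strong d l a S q" and light: "\<nexists>k. heavy d l S k"
  shows "structure_inv d l (push (step_vec d S q) S)"
proof -
  obtain k y X v \<delta> where *: "q = (k, y)" "k \<le> l + 3" "solves d (shifted (gram S) (weight S) (scale k)) a y"
    "X = strength d (weight S) (scale k) y" "1 / (4 * (real l + 4)) < X"
    "v = (\<lambda>i. scale k * y i / weight S i)" "\<delta> = 1 / (scale k * X)"
    "gram (push (step_vec d S q) S) = (\<lambda>i j. gram S i j + \<delta> * (v i * v j))"
    "\<forall>i. (step_vec d S q i)\<^sup>2 = \<delta> * (v i * v i)" "0 < \<delta>" "0 < X"
    by (rule strong_push[OF S q])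
  let ?S = "push (step_vec d S q) S"
  have ok: "cuts_ok S" and adm: "admissible d (gram S) (weight S)" using S by (simp_all add: structure_inv_def)
  \<comment> \<open>The weighted trace grows by exactly 1 and all weights are at least 1, so no
    diagonal entry grows by more than 1.\<close>
  have le1: "\<delta> * (v i * v i) \<le> 1" if "i < d" for i
  proof -
    have w: "1 \<le> weight S j" for j by (simp add: weight_def)
    have nn: "0 \<le> \<delta> * (v j * v j)" for j using *(10) by simp
    have "\<delta> * (v i * v i) \<le> weight S i * (\<delta> * (v i * v i))"
      using mult_right_mono[OF w nn, of i i] by simp
    also have "\<dots> \<le> (\<Sum>i<d. weight S i * (\<delta> * (v i * v i)))"
      using that nn w by (intro member_le_sum) (auto intro!: mult_nonneg_nonneg simp: weight_def)
    \<comment> \<open>The vector \<open>a\<close> is dominated by itself and serves as its own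
      comparator here.\<close>
    also have "\<dots> = 1"
      by (rule potential_step(2)[OF adm *(2,3) _ *(4,11,6,7), where P = 1 and b = "\<lambda>_. a"]) simp
    finally show ?thesis .
  qed
  have sumsq: "sumsq (cols ?S) i = sumsq (cols S) i + \<delta> * (v i * v i)" for i
    using *(9) by (simp add: push_def sumsq_append sumsq_Cons sumsq_Nil)
  have "gram S i i \<le> real (threshold l) + 1" if "i < d" for i
  proof -
    have "\<not> real (threshold l) < gram S i i - 1" using light that by (auto simp: heavy_def)
    thus ?thesis by simp
  qed
  hence "gram ?S i i \<le> real (threshold l) + 2" if "i < d" for i
    using le1[OF that] that unfolding *(8) by fastforce
  moreover have "sumsq (cols ?S) i \<le> real (level ?S i) * (real (threshold l) + 2) + gram ?S i i" if "i < d" for i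
    using S that unfolding *(8) sumsq by (simp add: structure_inv_def push_def[of _ S, THEN arg_cong[of _ _ level]])
  moreover have "admissible d (gram ?S) (weight ?S)"
    unfolding *(8) weight_push by (rule admissible_rank_one_update[OF adm less_imp_le[OF *(10)]])
  moreover have "level ?S = level S" by (simp add: push_def)
  ultimately show ?thesis
    using S cuts_ok_push[OF ok] out_covers_push[OF ok] out_bound_push[OF ok]
    by (simp add: structure_inv_def resets_push)
qed

text \<open>The potential falls by a third of the strength, which is at least
  \<open>1 / (12 * (l + 4))\<close> and pays for the increment of \<open>n\<close>. The weighted sum
  in the second inequality grows by 1, as does \<open>n\<close>.\<close>

lemma potential_inv_push:
  assumes S: "structure_inv d l S" "potential_inv d l P b n S" and q: "strong d l a S q"
    and a: "dominated d P b a"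
  shows "potential_inv d l P b (Suc n) (push (step_vec d S q) S)"
proof -
  obtain k y X v \<delta> where *: "q = (k, y)" "k \<le> l + 3" "solves d (shifted (gram S) (weight S) (scale k)) a y"
    "X = strength d (weight S) (scale k) y" "1 / (4 * (real l + 4)) < X"
    "v = (\<lambda>i. scale k * y i / weight S i)" "\<delta> = 1 / (scale k * X)"
    "gram (push (step_vec d S q) S) = (\<lambda>i j. gram S i j + \<delta> * (v i * v j))"
    "\<forall>i. (step_vec d S q i)\<^sup>2 = \<delta> * (v i * v i)" "0 < \<delta>" "0 < X"
    by (rule strong_push[OF S(1) q])
  let ?S = "push (step_vec d S q) S"
  have adm: "admissible d (gram S) (weight S)" using S by (simp add: structure_inv_def)
  have "potential d P b (l + 3) (gram ?S) (weight ?S) \<le> potential d P b (l + 3) (gram S) (weight S) - X / 3"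
    unfolding *(8) weight_push
    using a by (intro potential_step(1)[OF adm *(2,3) _ *(4,11,6,7)]) (simp add: dominated_def)
  moreover have "1 / (12 * (real l + 4)) \<le> X / 3"
    using *(5) by (simp add: field_simps)
  moreover have "real (Suc n) / (12 * (real l + 4)) = real n / (12 * (real l + 4)) + 1 / (12 * (real l + 4))"
    by (simp add: add_divide_distrib)
  moreover have "(\<Sum>i<d. weight S i * (\<delta> * (v i * v i))) = 1"
    by (rule potential_step(2)[OF adm *(2,3) _ *(4,11,6,7), where P = 1 and b = "\<lambda>_. a"]) simp
  hence "(\<Sum>i<d. weight S i * (gram ?S i i - 1) + real (threshold l) * (weight S i - 1))
     = (\<Sum>i<d. weight S i * (gram S i i - 1) + real (threshold l) * (weight S i - 1)) + 1"
    unfolding *(8) by (simp add: sum.distrib[symmetric] algebra_simps)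
      (simp add: sum.distrib sum_subtractf algebra_simps)
  ultimately show ?thesis
    using S(2) unfolding potential_inv_def weight_push by simp
qed

text \<open>A bootstrap for the total weight \<open>W\<close>, with \<open>T\<close> the threshold.
  As the potential is nonnegative, the first part of the invariant yields
  \<open>2 * n \<le> T * W\<close>; the second yields \<open>T * (W - d) \<le> n\<close>. Together
  they give \<open>W \<le> 2 * d\<close>, and the other bounds follow.\<close>

lemma potential_inv_bounds:
  assumes S: "structure_inv d l S" "potential_inv d l P b n S"
  shows "(\<Sum>i<d. weight S i) \<le> 2 * real d" "n \<le> threshold l * d" "resets S \<le> d"
    "i < d \<Longrightarrow> 2 ^ level S i \<le> 2 * real d"
proof -
  define W where "W = (\<Sum>i<d. weight S i)"
  define T where "T = real (threshold l)"
  have adm: "admissible d (gram S) (weight S)" using S by (simp add: structure_inv_def)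
  have w1: "1 \<le> weight S i" for i by (simp add: weight_def)
  have "0 \<le> potential d P b (l + 3) (gram S) (weight S)" by (rule potential_nonneg[OF adm])
  hence "real n / (12 * (real l + 4)) \<le> (real l + 4) * (2 * W)"
    using S(2) mult_left_mono[of "(\<Sum>i<d. 2 * weight S i - 1)" "2 * W" "real l + 4"]
    unfolding potential_inv_def W_def by (simp add: sum_subtractf sum_distrib_left)
  hence n1: "2 * real n \<le> T * W"
    by (simp add: pos_divide_le_eq T_def threshold_def power2_eq_square algebra_simps)
  have g1: "1 \<le> gram S i i" if "i < d" for i
  proof -
    have "gram S i i = dot d (\<lambda>j. if j = i then 1 else 0) (mv d (gram S) (\<lambda>j. if j = i then 1 else 0))"
      using that by (subst dot_commute, subst dot_unit) (simp_all add: mv_def if_distrib cong: if_cong)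
    also have "\<dots> \<ge> dot d (\<lambda>j. if j = i then 1 else 0) (\<lambda>j. if j = i then 1 else 0)"
      by (rule adm_form_ge[OF adm])
    finally show ?thesis using that by (simp add: dot_unit)
  qed
  have "(\<Sum>i<d. T * (weight S i - 1)) \<le> (\<Sum>i<d. weight S i * (gram S i i - 1) + T * (weight S i - 1))"
    using g1 w1 by (intro sum_mono) (auto simp: weight_def)
  also have "\<dots> \<le> n" using S(2) by (simp add: potential_inv_def T_def)
  finally have n2: "T * (W - real d) \<le> n"
    by (simp add: W_def sum_distrib_left[symmetric] sum_subtractf)
  have T: "0 < T" by (simp add: T_def threshold_def)
  have "T * (2 * (W - real d)) = 2 * (T * (W - real d))" by simp
  hence "T * (2 * (W - real d)) \<le> T * W" using n1 n2 by linarith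
  hence W: "W \<le> 2 * real d" using T by simp
  thus "(\<Sum>i<d. weight S i) \<le> 2 * real d" by (simp add: W_def)
  have "2 * real n \<le> T * (2 * real d)" using n1 W T by (meson mult_le_cancel_left_pos order_trans)
  thus "n \<le> threshold l * d" unfolding T_def by (simp flip: of_nat_mult)
  have "real (level S i) \<le> weight S i - 1" for i
  proof -
    have "Suc m \<le> 2 ^ m" for m :: nat by (induction m) auto
    from this[of "level S i"] have "real (Suc (level S i)) \<le> real (2 ^ level S i)" by (simp only: of_nat_le_iff)
    thus ?thesis by (simp add: weight_def)
  qed
  hence "real (\<Sum>i<d. level S i) \<le> (\<Sum>i<d. weight S i - 1)" by (simp add: sum_mono)
  hence "real (\<Sum>i<d. level S i) \<le> real d" using W by (simp add: W_def sum_subtractf)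
  thus "resets S \<le> d" using S(1) unfolding structure_inv_def of_nat_le_iff by simp
  show "2 ^ level S i \<le> 2 * real d" if "i < d"
    using member_le_sum[of i "{..<d}" "weight S"] that W by (auto simp: W_def weight_def)
qed

section \<open>Covering for a known value\<close>

definition settled :: "nat \<Rightarrow> nat \<Rightarrow> (nat \<Rightarrow> real) \<Rightarrow> state \<Rightarrow> bool" where
  "settled d l a S \<longleftrightarrow> (\<nexists>k. heavy d l S k) \<and> (\<nexists>q. strong d l a S q)"

text \<open>With no witness left, \<open>a\<close> is weak at all scales up to \<open>l + 3\<close>.
  The next scale is \<open>8 * 2 ^ l\<close>, which is large enough: entries of \<open>a\<close> are
  at most 1 in absolute value and the weights sum to at most \<open>2 * d\<close>.\<close>

lemma inv_form_settled:
  assumes S: "structure_inv d l S" "potential_inv d l P b n S"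
    and b: "comparator d P b" "dominated d P b a" and l: "d < 2 ^ l" and a: "settled d l a S"
  shows "inv_form d (gram S) a \<le> 1"
proof (rule inv_form_le_1[where K = "l + 3"])
  show "admissible d (gram S) (weight S)" using S by (simp add: structure_inv_def)
next
  fix k y assume "k \<le> l + 3" "solves d (shifted (gram S) (weight S) (scale k)) a y"
  hence "\<not> 1 / (4 * (real l + 4)) < strength d (weight S) (scale k) y"
    using a by (auto simp: settled_def strong_def)
  thus "strength d (weight S) (scale k) y \<le> 1 / (4 * (real (l + 3) + 1))" by (simp add: add.commute)
next
  have "(a i)\<^sup>2 \<le> 1" if i: "i < d" for i
  proof -
    have "(dot d (\<lambda>j. if j = i then 1 else 0) a)\<^sup>2 \<le> (\<Sum>p<P. (dot d (\<lambda>j. if j = i then 1 else 0) (b p))\<^sup>2)"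
      using b by (simp add: dominated_def)
    thus ?thesis
      using b i dot_unit[OF i, of _ 1] by (simp add: dot_commute[of d "\<lambda>j. if j = i then 1 else 0"] comparator_def) force
  qed
  hence "(\<Sum>i<d. weight S i * (a i)\<^sup>2) \<le> (\<Sum>i<d. weight S i * 1)"
    by (intro sum_mono mult_left_mono) (auto simp: weight_def)
  also have "\<dots> \<le> 2 * real d" using potential_inv_bounds(1)[OF S] by simp
  also have "\<dots> \<le> 2 * real (2 ^ l)" using l by (simp only: mult_le_cancel_left_pos of_nat_le_iff)
  finally show "4 * (\<Sum>i<d. weight S i * (a i)\<^sup>2) \<le> scale (Suc (l + 3))"
    by (simp add: scale_def power_add)
qed

text \<open>Passing from multiples of \<open>2 ^ h\<close> to multiples of \<open>2 ^ Suc h\<close>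
  clears the binary digit \<open>h\<close> of \<open>n\<close>.\<close>

lemma div_power_Suc:
  fixes n h :: nat
  defines "e \<equiv> n div 2 ^ h * 2 ^ h" and "e' \<equiv> n div 2 ^ Suc h * 2 ^ Suc h"
  shows "e' = e \<or> e' = e - 2 ^ h \<and> 0 < e"
proof -
  define q where "q = n div 2 ^ h"
  have "n div 2 ^ Suc h = q div 2"
    by (simp add: q_def div_mult2_eq[of n "2 ^ h" 2, symmetric] mult.commute)
  hence e': "e' = (q div 2 * 2) * 2 ^ h" by (simp add: e'_def)
  have e: "e = q * 2 ^ h" by (simp add: e_def q_def)
  show ?thesis
  proof (cases "even q")
    case False
    hence "q div 2 * 2 = q - 1" "0 < q" by (auto elim: oddE)
    thus ?thesis by (simp add: e e' diff_mult_distrib)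
  qed (simp add: e e')
qed

text \<open>Clearing the binary digits of the number of resets from the lowest upwards leads from
  the current cut to the initial zero cut, as there are fewer than \<open>2 ^ l\<close> resets. Each
  cleared digit is one dyadic segment.\<close>

lemma entry_decomp:
  assumes ok: "cuts_ok S" and N: "resets S < 2 ^ l" and t: "t < length (cols S)"
  defines "c \<equiv> \<lambda>h. cuts S ! (resets S div 2 ^ h * 2 ^ h)"
  shows "entry S t i = (cols S ! t) i - (\<Sum>h<l. segment S (c (Suc h)) (c h) t i)"
proof -
  have less: "resets S div 2 ^ h * 2 ^ h < length (cuts S)" for h
  proof -
    have "resets S div 2 ^ h * 2 ^ h \<le> resets S" by simp
    also have "\<dots> < length (cuts S)" using ok by (auto simp: resets_def cuts_ok_def)
    finally show ?thesis .
  qed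
  have mono: "c (Suc h) i \<le> c h i" for h
  proof -
    have "resets S div 2 ^ Suc h * 2 ^ Suc h \<le> resets S div 2 ^ h * 2 ^ h"
      using div_power_Suc[of "resets S" h] by (elim disjE conjE) (simp_all only: diff_le_self order_refl)
    thus ?thesis unfolding c_def by (rule cuts_mono[OF ok _ less])
  qed
  have "(\<Sum>h<l. segment S (c (Suc h)) (c h) t i) = (if c l i \<le> t \<and> t < c 0 i then (cols S ! t) i else 0)"
    unfolding segment_def by (rule telescope_indicator[of "\<lambda>h. c h i", OF mono])
  moreover have "c l i = 0" using N ok by (simp add: c_def cuts_ok_def)
  moreover have "c 0 i = cut S i" using ok by (simp add: c_def cut_def resets_def last_conv_nth cuts_ok_def)
  ultimately show ?thesis by (simp add: entry_def)
qed

text \<open>If \<open>y\<close> solves the Gram system for \<open>a\<close>, the truncated columns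
  combine to \<open>a\<close> with the coefficients \<open>dot d (entry S t) y\<close>, whose
  squared norm is the inverse form, at most 1. The full columns with these coefficients cost norm 1,
  and so does each of the \<open>l\<close> dyadic corrections.\<close>

lemma covers_settled:
  assumes S: "structure_inv d l S" and N: "resets S < 2 ^ l" and a: "inv_form d (gram S) a \<le> 1"
  shows "covers d (out S) (real l + 1) a"
proof -
  have ok: "cuts_ok S" and oc: "out_covers d l S" and adm: "admissible d (gram S) (weight S)"
    using S by (simp_all add: structure_inv_def)
  obtain y where y: "solves d (gram S) a y"
    using adm_solve[OF adm, of 0 a] by (auto simp: shifted_0)
  define n where "n = length (cols S)"
  define r where "r t = dot d (entry S t) y" for t
  define c where "c h = cuts S ! (resets S div 2 ^ h * 2 ^ h)" for h
  have mv: "mv d (gram S) y i = (\<Sum>t<n. r t * entry S t i)" for i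
  proof -
    have "mv d (gram S) y i = (\<Sum>j<d. \<Sum>t<n. entry S t i * entry S t j * y j)"
      by (simp add: mv_def gram_def sum_distrib_right n_def)
    also have "\<dots> = (\<Sum>t<n. \<Sum>j<d. entry S t i * entry S t j * y j)" by (rule sum.swap)
    finally show ?thesis by (simp add: r_def dot_def sum_distrib_right sum_distrib_left mult_ac)
  qed
  have "(\<Sum>t<n. (r t)\<^sup>2) = dot d y (mv d (gram S) y)"
  proof -
    have "dot d y (mv d (gram S) y) = (\<Sum>i<d. \<Sum>t<n. y i * (r t * entry S t i))"
      by (simp add: dot_def mv sum_distrib_left)
    also have "\<dots> = (\<Sum>t<n. \<Sum>i<d. y i * (r t * entry S t i))" by (rule sum.swap)
    also have "\<dots> = (\<Sum>t<n. r t * r t)"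
      by (intro sum.cong refl) (simp add: r_def[of t for t] dot_def sum_distrib_left mult_ac)
    finally show ?thesis by (simp add: power2_eq_square)
  qed
  also have "\<dots> \<le> 1"
    using a inv_form_eq[OF adm_symm[OF adm, of 0]] y dot_solves[OF y, of y] by (simp add: shifted_0 dot_commute)
  finally have r1: "(\<Sum>t<n. (r t)\<^sup>2) \<le> 1" .
  have main: "covers d (out S) 1 (\<lambda>i. \<Sum>t<n. r t * (cols S ! t) i)"
  proof -
    have "covers d (out S) (sqrt (\<Sum>t<n. (r t)\<^sup>2)) (\<lambda>i. \<Sum>t<n. r t * (cols S ! t) i)"
      using oc by (simp add: out_covers_def n_def)
    moreover have "(sqrt (\<Sum>t<n. (r t)\<^sup>2))\<^sup>2 \<le> 1\<^sup>2" using r1 by (simp add: sum_nonneg)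
    ultimately show ?thesis unfolding covers_def by (meson order_trans)
  qed
  have parts: "covers d (out S) 1 (\<lambda>i. - (\<Sum>t<n. r t * segment S (c (Suc h)) (c h) t i))" if h: "h < l" for h
  proof (rule covers_uminus)
    let ?e = "resets S div 2 ^ h * 2 ^ h"
    consider "c (Suc h) = c h" | "c (Suc h) = cuts S ! (?e - 2 ^ h)" "0 < ?e"
      unfolding c_def using div_power_Suc[of "resets S" h] by metis
    thus "covers d (out S) 1 (\<lambda>i. \<Sum>t<n. r t * segment S (c (Suc h)) (c h) t i)"
    proof cases
      case 1
      have "segment S (c h) (c h) t i = 0" for t i by (simp add: segment_def)
      thus ?thesis
        unfolding covers_def 1 by (intro exI[of _ "\<lambda>_. 0"]) simp
    next
      case 2
      have "?e \<le> resets S" by simp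
      also have "\<dots> < length (cuts S)" using ok by (auto simp: resets_def cuts_ok_def)
      finally have e: "?e < length (cuts S)" .
      show ?thesis
        using oc r1 2(2) e h unfolding out_covers_def 2(1) c_def[of h] n_def[symmetric] by auto
    qed
  qed
  have "covers d (out S) (1 + real l)
      (\<lambda>i. (\<Sum>t<n. r t * (cols S ! t) i) + (\<Sum>h<l. - (\<Sum>t<n. r t * segment S (c (Suc h)) (c h) t i)))"
    by (intro covers_add[OF main covers_sum[OF parts]]) simp_all
  moreover have "(\<Sum>t<n. r t * (cols S ! t) i) + (\<Sum>h<l. - (\<Sum>t<n. r t * segment S (c (Suc h)) (c h) t i)) = a i"
    if i: "i < d" for i
  proof -
    have "a i = (\<Sum>t<n. r t * entry S t i)" using y i mv[of i] by (simp add: solves_def)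
    also have "\<dots> = (\<Sum>t<n. r t * (cols S ! t) i - (\<Sum>h<l. r t * segment S (c (Suc h)) (c h) t i))"
      by (intro sum.cong refl) (simp add: entry_decomp[OF ok N] n_def c_def right_diff_distrib sum_distrib_left)
    also have "\<dots> = (\<Sum>t<n. r t * (cols S ! t) i) - (\<Sum>t<n. \<Sum>h<l. r t * segment S (c (Suc h)) (c h) t i)"
      by (simp add: sum_subtractf)
    also have "(\<Sum>t<n. \<Sum>h<l. r t * segment S (c (Suc h)) (c h) t i) = (\<Sum>h<l. \<Sum>t<n. r t * segment S (c (Suc h)) (c h) t i)"
      by (rule sum.swap)
    finally show ?thesis by (simp add: sum_negf)
  qed
  ultimately show ?thesis
    by (metis (no_types, lifting) covers_cong add.commute)
qed

text \<open>A fixed count replaces a loop until \<open>settled\<close>. As long as a comparator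
  dominates the vectors, at most \<open>threshold l * d\<close> pushes and \<open>d\<close> resets
  occur, so one tick more suffices.\<close>

definition insert_vec :: "nat \<Rightarrow> nat \<Rightarrow> (nat \<Rightarrow> real) \<Rightarrow> state \<Rightarrow> state" where
  "insert_vec d l a S = (tick d l a ^^ (threshold l * d + d + 1)) S"

definition run :: "nat \<Rightarrow> nat \<Rightarrow> (nat \<Rightarrow> real) list \<Rightarrow> state" where
  "run d l xs = fold (insert_vec d l) xs (init d)"

lemma out_tick: "\<exists>D. out (tick d l a S) = out S @ D"
  by (auto simp: tick_def reset_def push_def)

lemma out_insert_vec: "\<exists>D. out (insert_vec d l a S) = out S @ D"
proof -
  have "\<exists>D. out ((tick d l a ^^ m) S) = out S @ D" for m
  proof (induction m)
    case (Suc m)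
    thus ?case using out_tick[of d l a "(tick d l a ^^ m) S"] by fastforce
  qed simp
  thus ?thesis unfolding insert_vec_def .
qed

lemma out_run_snoc: "\<exists>D. out (run d l (xs @ [x])) = out (run d l xs) @ D"
  by (simp add: run_def out_insert_vec)

lemma tick_settled: "settled d l a S \<Longrightarrow> tick d l a S = S"
  by (simp add: tick_def settled_def)

text \<open>Every tick on an unsettled vector is a push or a reset, so \<open>n + resets S\<close>
  counts the ticks.\<close>

lemma tick_inv:
  assumes S: "structure_inv d l S" "potential_inv d l P b n S"
    and b: "comparator d P b" "dominated d P b a" and a: "\<not> settled d l a S"
  shows "\<exists>n'. structure_inv d l (tick d l a S) \<and> potential_inv d l P b n' (tick d l a S)
    \<and> n' + resets (tick d l a S) = Suc (n + resets S)"
proof (cases "\<exists>k. heavy d l S k")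
  case True
  define k where "k = (SOME k. heavy d l S k)"
  have k: "heavy d l S k" using True unfolding k_def by (rule someI_ex)
  have "cuts S \<noteq> []" using S by (simp add: structure_inv_def cuts_ok_def)
  thus ?thesis
    using structure_inv_reset[OF S(1) k] potential_inv_reset[OF S k b(1)] True
    by (auto simp: tick_def k_def[symmetric] resets_reset)
next
  case False
  define q where "q = (SOME q. strong d l a S q)"
  have ex: "\<exists>q. strong d l a S q" using a False by (simp add: settled_def)
  hence q: "strong d l a S q" unfolding q_def by (rule someI_ex)
  have "tick d l a S = push (step_vec d S q) S" using False ex by (simp add: tick_def q_def)
  thus ?thesis
    using structure_inv_push[OF S(1) q False] potential_inv_push[OF S q b(2)] by (auto simp: resets_push)
qed

lemma insert_vec_inv:
  assumes S: "structure_inv d l S" "potential_inv d l P b n S"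
    and b: "comparator d P b" "dominated d P b a"
  shows "\<exists>n'. structure_inv d l (insert_vec d l a S) \<and> potential_inv d l P b n' (insert_vec d l a S)
    \<and> settled d l a (insert_vec d l a S)"
proof -
  have "\<exists>n'. structure_inv d l ((tick d l a ^^ m) S) \<and> potential_inv d l P b n' ((tick d l a ^^ m) S)
    \<and> (settled d l a ((tick d l a ^^ m) S) \<or> m \<le> n' + resets ((tick d l a ^^ m) S))" for m
  proof (induction m)
    case 0
    show ?case using S by auto
  next
    case (Suc m)
    then obtain n' where n': "structure_inv d l ((tick d l a ^^ m) S)" "potential_inv d l P b n' ((tick d l a ^^ m) S)"
      "settled d l a ((tick d l a ^^ m) S) \<or> m \<le> n' + resets ((tick d l a ^^ m) S)" by blast
    show ?case
    proof (cases "settled d l a ((tick d l a ^^ m) S)")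
      case True
      thus ?thesis using n' by (auto simp: tick_settled)
    next
      case False
      obtain n'' where "structure_inv d l ((tick d l a ^^ Suc m) S)" "potential_inv d l P b n'' ((tick d l a ^^ Suc m) S)"
        "n'' + resets ((tick d l a ^^ Suc m) S) = Suc (n' + resets ((tick d l a ^^ m) S))"
        using tick_inv[OF n'(1,2) b False] by auto
      thus ?thesis using n'(3) False by (intro exI[of _ n'']) auto
    qed
  qed
  from this[of "threshold l * d + d + 1"] obtain n' where n': "structure_inv d l (insert_vec d l a S)"
    "potential_inv d l P b n' (insert_vec d l a S)"
    "settled d l a (insert_vec d l a S) \<or> threshold l * d + d + 1 \<le> n' + resets (insert_vec d l a S)"
    unfolding insert_vec_def by blast
  thus ?thesis
    using potential_inv_bounds(2,3)[OF n'(1,2)] by (intro exI[of _ n']) auto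
qed

lemma run_inv:
  assumes b: "comparator d P b" "\<And>x. x \<in> set xs \<Longrightarrow> dominated d P b x"
  shows "\<exists>n. structure_inv d l (run d l xs) \<and> potential_inv d l P b n (run d l xs)
    \<and> (xs \<noteq> [] \<longrightarrow> settled d l (last xs) (run d l xs))"
  using b(2)
proof (induction xs rule: rev_induct)
  case Nil
  show ?case using structure_inv_init potential_inv_init[OF b(1)] by (auto simp: run_def)
next
  case (snoc x xs)
  then obtain n where "structure_inv d l (run d l xs)" "potential_inv d l P b n (run d l xs)" by auto
  from insert_vec_inv[OF this b(1), of x] show ?case using snoc.prems by (auto simp: run_def)
qed

text \<open>Per coordinate, at most \<open>l\<close> resets and the present diagonal entry give
  \<open>l + 1\<close> times \<open>threshold l + 2\<close>; the output repeats the columns at most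
  \<open>l + 1\<close> times.\<close>

definition cover_bound :: "nat \<Rightarrow> real" where
  "cover_bound l = (real l + 1)\<^sup>2 * (real (threshold l) + 2)"

lemma run_bound:
  assumes b: "comparator d P b" "\<And>x. x \<in> set xs \<Longrightarrow> dominated d P b x" and l: "d < 2 ^ l" and i: "i < d"
  shows "sumsq (out (run d l xs)) i \<le> cover_bound l"
proof -
  obtain n where S: "structure_inv d l (run d l xs)" "potential_inv d l P b n (run d l xs)"
    using run_inv[OF b] by blast
  let ?S = "run d l xs"
  \<comment> \<open>The level is at most \<open>l\<close>, because
    \<open>2 ^ level \<le> 2 * d < 2 ^ (l + 1)\<close>.\<close>
  have "(2::real) ^ level ?S i \<le> 2 * real d" by (rule potential_inv_bounds(4)[OF S i])
  also have "\<dots> < 2 * real (2 ^ l)" using l by (simp only: mult_less_cancel_left_pos of_nat_less_iff)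
  finally have "(2::real) ^ level ?S i < 2 ^ Suc l" by simp
  hence "level ?S i \<le> l" by (simp add: power_strict_increasing_iff less_Suc_eq_le del: power_Suc)
  hence "real (level ?S i) * (real (threshold l) + 2) + gram ?S i i \<le> real l * (real (threshold l) + 2) + (real (threshold l) + 2)"
    using S(1) i by (intro add_mono mult_right_mono) (simp_all add: structure_inv_def)
  moreover have "sumsq (cols ?S) i \<le> real (level ?S i) * (real (threshold l) + 2) + gram ?S i i"
    using S(1) i unfolding structure_inv_def by blast
  ultimately have "sumsq (cols ?S) i \<le> (real l + 1) * (real (threshold l) + 2)"
    by (simp add: distrib_right)
  hence "(real l + 1) * sumsq (cols ?S) i \<le> (real l + 1) * ((real l + 1) * (real (threshold l) + 2))"
    by (intro mult_left_mono) simp_all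
  moreover have "sumsq (out ?S) i \<le> (real l + 1) * sumsq (cols ?S) i"
    using S(1) by (intro out_bound_le) (simp add: structure_inv_def)
  moreover have "cover_bound l = (real l + 1) * ((real l + 1) * (real (threshold l) + 2))"
    by (simp only: cover_bound_def power2_eq_square mult.assoc)
  ultimately show ?thesis by linarith
qed

lemma run_covers:
  assumes b: "comparator d P b" "\<And>x. x \<in> set xs \<Longrightarrow> dominated d P b x" and l: "d < 2 ^ l" and xs: "xs \<noteq> []"
  shows "covers d (out (run d l xs)) (real l + 1) (last xs)"
proof -
  obtain n where S: "structure_inv d l (run d l xs)" "potential_inv d l P b n (run d l xs)" "settled d l (last xs) (run d l xs)"
    using run_inv[OF b] xs by blast
  show ?thesis
    using inv_form_settled[OF S(1,2) b(1) _ l S(3)] b(2) xs potential_inv_bounds(3)[OF S(1,2)] l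
    by (intro covers_settled[OF S(1)]) auto
qed

section \<open>Guessing the value\<close>

text \<open>An offline certificate for the value \<open>g\<close>. Every \<open>g\<close> above
  \<open>gamma2\<close> has one (\<open>coverable_rows\<close>, \<open>coverable_columns\<close>),
  and it persists on sublists.\<close>

definition coverable :: "nat \<Rightarrow> real \<Rightarrow> real list list \<Rightarrow> bool" where
  "coverable d g xs \<longleftrightarrow> (\<exists>P b. (\<forall>i<d. (\<Sum>p<P. (b p i)\<^sup>2) \<le> g\<^sup>2) \<and> (\<forall>x\<in>set xs. dominated d P b ((!) x)))"

text \<open>The unit in which values are guessed. It stays 0 while only zero vectors have arrived
  and is then fixed by the first nonzero one.\<close>

definition first_linf :: "real list list \<Rightarrow> real" where
  "first_linf xs = (case filter (\<lambda>x. 0 < linf x) xs of [] \<Rightarrow> 0 | x # _ \<Rightarrow> linf x)"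

definition phase :: "nat \<Rightarrow> real list list \<Rightarrow> nat" where
  "phase d xs = (LEAST k. coverable d (first_linf xs * 2 ^ k) xs)"

definition guess :: "nat \<Rightarrow> real list list \<Rightarrow> real" where
  "guess d xs = first_linf xs * 2 ^ phase d xs"

text \<open>The covering process is replayed on the whole list, scaled by the current guess. The
  column factor \<open>\<sigma>\<close> is a parameter because the two arrival models split the cost
  between columns and answers differently.\<close>

definition phase_columns :: "nat \<Rightarrow> nat \<Rightarrow> (real \<Rightarrow> nat \<Rightarrow> real) \<Rightarrow> real list list \<Rightarrow> real list list" where
  "phase_columns d l \<sigma> xs = map (\<lambda>c. map (\<lambda>i. \<sigma> (first_linf xs) (phase d xs) * c i) [0..<d])
     (out (run d l (map (\<lambda>x i. x ! i / guess d xs) xs)))"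

text \<open>Within a phase the replayed run extends the previous one, so only its new columns are
  appended. A new phase emits its run in full.\<close>

definition appended :: "nat \<Rightarrow> nat \<Rightarrow> (real \<Rightarrow> nat \<Rightarrow> real) \<Rightarrow> real list list \<Rightarrow> real list list" where
  "appended d l \<sigma> xs = (if first_linf xs = 0 then []
     else if first_linf (butlast xs) = first_linf xs \<and> phase d (butlast xs) = phase d xs
     then drop (length (phase_columns d l \<sigma> (butlast xs))) (phase_columns d l \<sigma> xs)
     else phase_columns d l \<sigma> xs)"

definition accum :: "nat \<Rightarrow> nat \<Rightarrow> (real \<Rightarrow> nat \<Rightarrow> real) \<Rightarrow> real list list \<Rightarrow> real list list" where
  "accum d l \<sigma> xs = concat (map (\<lambda>i. appended d l \<sigma> (take i xs)) [1..<Suc (length xs)])"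

definition answer_bound :: "nat \<Rightarrow> nat \<Rightarrow> (real \<Rightarrow> nat \<Rightarrow> real) \<Rightarrow> real list list \<Rightarrow> real" where
  "answer_bound d l \<sigma> xs = (real l + 1) * guess d xs / \<sigma> (first_linf xs) (phase d xs)"

definition accum_bound :: "nat \<Rightarrow> nat \<Rightarrow> (real \<Rightarrow> nat \<Rightarrow> real) \<Rightarrow> real list list \<Rightarrow> real" where
  "accum_bound d l \<sigma> xs = (if first_linf xs = 0 then 0 else cover_bound l * (\<Sum>k\<le>phase d xs. (\<sigma> (first_linf xs) k)\<^sup>2))"

definition is_answer :: "nat \<Rightarrow> nat \<Rightarrow> (real \<Rightarrow> nat \<Rightarrow> real) \<Rightarrow> real list list \<Rightarrow> real list \<Rightarrow> bool" where
  "is_answer d l \<sigma> xs r \<longleftrightarrow> length r = length (accum d l \<sigma> xs) \<and> vecmat r (accum d l \<sigma> xs) d = last xs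
     \<and> norm2 r \<le> answer_bound d l \<sigma> xs"

definition online :: "nat \<Rightarrow> nat \<Rightarrow> (real \<Rightarrow> nat \<Rightarrow> real) \<Rightarrow> online_alg" where
  "online d l \<sigma> = ([], \<lambda>xs. (appended d l \<sigma> xs, SOME r. is_answer d l \<sigma> xs r))"

lemma linf_nonneg: "0 \<le> linf x"
  by (simp add: linf_def)

lemma abs_le_linf: "i < length x \<Longrightarrow> \<bar>x ! i\<bar> \<le> linf x"
  by (simp add: linf_def)

lemma linf_attained: "0 < linf x \<Longrightarrow> \<exists>i<length x. linf x = \<bar>x ! i\<bar>"
proof -
  assume "0 < linf x"
  moreover have "linf x \<in> insert 0 (abs ` set x)" unfolding linf_def by (rule Max_in) auto
  ultimately show ?thesis by (auto simp: in_set_conv_nth)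
qed

lemma first_linf_nonneg: "0 \<le> first_linf xs"
  by (simp add: first_linf_def linf_nonneg split: list.split)

lemma first_linf_snoc: "first_linf (xs @ [x]) = (if first_linf xs = 0 then linf x else first_linf xs)"
proof (cases "filter (\<lambda>x. 0 < linf x) xs")
  case Nil
  thus ?thesis using linf_nonneg[of x] by (auto simp: first_linf_def)
next
  case (Cons y ys)
  hence "y \<in> set (filter (\<lambda>x. 0 < linf x) xs)" by simp
  hence "0 < linf y" by simp
  thus ?thesis by (simp add: first_linf_def Cons)
qed

lemma first_linf_attained:
  assumes "0 < first_linf xs" shows "\<exists>x\<in>set xs. first_linf xs = linf x"
proof (cases "filter (\<lambda>x. 0 < linf x) xs")
  case (Cons y ys)
  hence "y \<in> set (filter (\<lambda>x. 0 < linf x) xs)" by simp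
  hence "y \<in> set xs" by simp
  thus ?thesis by (auto simp: first_linf_def Cons)
qed (use assms in \<open>simp add: first_linf_def\<close>)

lemma first_linf_0: "first_linf xs = 0 \<Longrightarrow> x \<in> set xs \<Longrightarrow> linf x = 0"
proof -
  assume *: "first_linf xs = 0" "x \<in> set xs"
  have "filter (\<lambda>x. 0 < linf x) xs = []"
  proof (cases "filter (\<lambda>x. 0 < linf x) xs")
    case (Cons y ys)
    hence "y \<in> set (filter (\<lambda>x. 0 < linf x) xs)" by simp
    hence "0 < linf y" by simp
    thus ?thesis using *(1) by (simp add: first_linf_def Cons)
  qed
  thus ?thesis using *(2) linf_nonneg[of x] by (auto simp: filter_empty_conv)
qed

lemma coverable_subset: "coverable d g xs \<Longrightarrow> set ys \<subseteq> set xs \<Longrightarrow> coverable d g ys"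
  unfolding coverable_def by blast

lemma coverable_entry:
  assumes c: "coverable d g xs" and x: "x \<in> set xs" and i: "i < d" and g: "0 \<le> g"
  shows "\<bar>x ! i\<bar> \<le> g"
proof -
  obtain P b where b: "\<And>i. i < d \<Longrightarrow> (\<Sum>p<P. (b p i)\<^sup>2) \<le> g\<^sup>2" "dominated d P b ((!) x)"
    using c x unfolding coverable_def by blast
  have "(dot d (\<lambda>j. if j = i then 1 else 0) ((!) x))\<^sup>2 \<le> (\<Sum>p<P. (dot d (\<lambda>j. if j = i then 1 else 0) (b p))\<^sup>2)"
    using b(2) unfolding dominated_def by blast
  also have "\<dots> \<le> g\<^sup>2"
    using b(1)[OF i] dot_unit[OF i, of _ 1] by (simp add: dot_commute[of d "\<lambda>j. if j = i then 1 else 0"])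
  finally have "(x ! i)\<^sup>2 \<le> g\<^sup>2"
    using dot_unit[OF i, of _ 1] by (simp add: dot_commute[of d "\<lambda>j. if j = i then 1 else 0"])
  thus ?thesis using g by (metis abs_le_square_iff abs_of_nonneg)
qed

lemma coverable_exists:
  assumes "0 < \<beta>" shows "\<exists>k. coverable d (\<beta> * 2 ^ k) xs"
proof -
  define B where "B = (\<Sum>i<d. \<Sum>p<length xs. (xs ! p ! i)\<^sup>2)"
  obtain k where k: "(B + 1) / \<beta> < 2 ^ k" using real_arch_pow[of 2 "(B + 1) / \<beta>"] by auto
  have B0: "0 \<le> B" by (simp add: B_def sum_nonneg)
  have "B + 1 \<le> \<beta> * 2 ^ k" using k assms by (simp add: pos_divide_less_eq mult.commute)
  hence "B \<le> (\<beta> * 2 ^ k)\<^sup>2"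
    using B0 by (smt (verit) mult_left_le power2_eq_square mult_le_cancel_left1)
  moreover have "(\<Sum>p<length xs. (xs ! p ! i)\<^sup>2) \<le> B" if "i < d" for i
    unfolding B_def using that by (intro member_le_sum[of i "{..<d}" "\<lambda>i. \<Sum>p<length xs. (xs ! p ! i)\<^sup>2"]) (auto intro: sum_nonneg)
  moreover have "dominated d (length xs) (\<lambda>p i. xs ! p ! i) ((!) x)" if x: "x \<in> set xs" for x
  proof -
    obtain p where p: "p < length xs" "x = xs ! p" using x by (auto simp: in_set_conv_nth)
    show ?thesis
      unfolding dominated_def p(2) using p(1)
      by (intro allI member_le_sum[of p "{..<length xs}" "\<lambda>p. (dot d _ (\<lambda>i. xs ! p ! i))\<^sup>2"]) auto
  qed
  ultimately have "coverable d (\<beta> * 2 ^ k) xs"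
    unfolding coverable_def by (intro exI[of _ "length xs"] exI[of _ "\<lambda>p i. xs ! p ! i"]) force
  thus ?thesis ..
qed

lemma coverable_guess: "0 < first_linf xs \<Longrightarrow> coverable d (guess d xs) xs"
  unfolding guess_def phase_def using coverable_exists[of "first_linf xs" d xs] by (rule LeastI_ex)

lemma phase_mono:
  assumes "0 < first_linf xs" "first_linf ys = first_linf xs" "set xs \<subseteq> set ys"
  shows "phase d xs \<le> phase d ys"
  unfolding phase_def[of d xs]
  using coverable_subset[OF coverable_guess[of ys d] assms(3)] assms(1,2)
  by (intro Least_le) (simp add: guess_def)

lemma guess_pos: "0 < first_linf xs \<Longrightarrow> 0 < guess d xs"
  by (simp add: guess_def)

text \<open>Either the phase is 0 and the guess is the norm of a vector in the list, or the previous
  guess was not coverable and hence at most \<open>\<gamma>\<close>.\<close>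

lemma guess_le:
  assumes b: "0 < first_linf xs" and len: "\<And>x. x \<in> set xs \<Longrightarrow> length x = d"
    and \<gamma>: "0 \<le> \<gamma>" "\<And>g. \<gamma> < g \<Longrightarrow> coverable d g xs"
  shows "first_linf xs \<le> \<gamma>" "guess d xs \<le> 2 * \<gamma>"
proof -
  obtain x where x: "x \<in> set xs" "first_linf xs = linf x" using first_linf_attained[OF b] by blast
  obtain i where i: "i < d" "linf x = \<bar>x ! i\<bar>" using linf_attained[of x] b x len by auto
  have "first_linf xs \<le> g" if "\<gamma> < g" for g
    using coverable_entry[OF \<gamma>(2)[OF that] x(1) i(1)] \<gamma>(1) that by (simp add: x(2) i(2))
  thus le: "first_linf xs \<le> \<gamma>" by (meson dense_ge)
  show "guess d xs \<le> 2 * \<gamma>"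
  proof (cases "phase d xs")
    case 0
    thus ?thesis using le b by (simp add: guess_def)
  next
    case (Suc k)
    hence "\<not> coverable d (first_linf xs * 2 ^ k) xs" unfolding phase_def by (metis lessI not_less_Least)
    hence "first_linf xs * 2 ^ k \<le> \<gamma>" using \<gamma>(2) by force
    thus ?thesis by (simp add: guess_def Suc)
  qed
qed

lemma accum_Nil: "accum d l \<sigma> [] = []"
  by (simp add: accum_def)

lemma accum_snoc: "accum d l \<sigma> (xs @ [x]) = accum d l \<sigma> xs @ appended d l \<sigma> (xs @ [x])"
proof -
  have eq: "map (\<lambda>i. appended d l \<sigma> (take i (xs @ [x]))) [1..<Suc (length xs)] = map (\<lambda>i. appended d l \<sigma> (take i xs)) [1..<Suc (length xs)]"
    by (intro map_cong) auto
  have upt: "[1..<Suc (length (xs @ [x]))] = [1..<Suc (length xs)] @ [Suc (length xs)]" by simp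
  show ?thesis unfolding accum_def upt map_append eq concat_append by simp
qed

lemma length_phase_columns: "r \<in> set (phase_columns d l \<sigma> xs) \<Longrightarrow> length r = d"
  by (auto simp: phase_columns_def)

lemma length_accum: "r \<in> set (accum d l \<sigma> xs) \<Longrightarrow> length r = d"
  by (auto simp: accum_def appended_def dest!: in_set_dropD length_phase_columns split: if_splits)

definition colsq :: "real list list \<Rightarrow> nat \<Rightarrow> real" where
  "colsq R i = (\<Sum>r\<leftarrow>R. (r ! i)\<^sup>2)"

lemma colsq_append: "colsq (R @ T) i = colsq R i + colsq T i"
  by (simp add: colsq_def)

lemma normalized_comparator:
  assumes "0 < first_linf xs"
  obtains P b where "comparator d P b" "\<forall>x\<in>set (map (\<lambda>x i. x ! i / guess d xs) xs). dominated d P b x"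
proof -
  define g where "g = guess d xs"
  have g: "0 < g" using guess_pos[OF assms] by (simp add: g_def)
  obtain P b where b: "\<And>i. i < d \<Longrightarrow> (\<Sum>p<P. (b p i)\<^sup>2) \<le> g\<^sup>2" "\<And>x. x \<in> set xs \<Longrightarrow> dominated d P b ((!) x)"
    using coverable_guess[OF assms, of d] unfolding coverable_def g_def by blast
  have dot_div: "dot d u (\<lambda>i. v i / g) = dot d u v / g" for u v
    by (simp add: dot_def sum_divide_distrib)
  show ?thesis
  proof (rule that[of P "\<lambda>p i. b p i / g"])
    show "comparator d P (\<lambda>p i. b p i / g)"
      unfolding comparator_def
    proof (intro allI impI)
      fix i assume "i < d"
      have "(\<Sum>p<P. (b p i / g)\<^sup>2) = (\<Sum>p<P. (b p i)\<^sup>2) / g\<^sup>2" by (simp add: power_divide sum_divide_distrib)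
      thus "(\<Sum>p<P. (b p i / g)\<^sup>2) \<le> 1" using b(1)[OF \<open>i < d\<close>] g by (simp add: pos_divide_le_eq)
    qed
    show "\<forall>x\<in>set (map (\<lambda>x i. x ! i / guess d xs) xs). dominated d P (\<lambda>p i. b p i / g) x"
    proof
      fix x assume x: "x \<in> set (map (\<lambda>x i. x ! i / guess d xs) xs)"
      obtain z where z: "z \<in> set xs" "x = (\<lambda>i. z ! i / g)" using x by (auto simp: g_def)
      have "(dot d u ((!) z))\<^sup>2 / g\<^sup>2 \<le> (\<Sum>p<P. (dot d u (b p))\<^sup>2) / g\<^sup>2" for u
        using b(2)[OF z(1)] by (intro divide_right_mono) (auto simp: dominated_def)
      thus "dominated d P (\<lambda>p i. b p i / g) x"
        unfolding dominated_def z(2) dot_div by (simp add: power_divide sum_divide_distrib)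
    qed
  qed
qed

lemma colsq_phase_columns:
  assumes b: "0 < first_linf xs" and l: "d < 2 ^ l" and i: "i < d"
  shows "colsq (phase_columns d l \<sigma> xs) i \<le> cover_bound l * (\<sigma> (first_linf xs) (phase d xs))\<^sup>2"
proof -
  let ?S = "run d l (map (\<lambda>x i. x ! i / guess d xs) xs)"
  obtain P b where cmp: "comparator d P b" "\<forall>x\<in>set (map (\<lambda>x i. x ! i / guess d xs) xs). dominated d P b x"
    using normalized_comparator[OF b, of d] .
  have "sumsq (out ?S) i \<le> cover_bound l" using cmp by (intro run_bound[OF _ _ l i]) auto
  moreover have "colsq (phase_columns d l \<sigma> xs) i = (\<sigma> (first_linf xs) (phase d xs))\<^sup>2 * sumsq (out ?S) i"
    using i by (simp add: colsq_def phase_columns_def sumsq_def o_def power_mult_distrib sum_list_const_mult)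
  ultimately show ?thesis by (metis mult.commute mult_left_mono zero_le_power2)
qed

lemma cover_bound_pos: "0 < cover_bound l"
  by (simp add: cover_bound_def add_nonneg_pos)

text \<open>The accumulated list ends with the complete output of the current phase;
  \<open>R\<close> collects the abandoned phases, each costing at most \<open>cover_bound l\<close>
  times the square of its \<open>\<sigma>\<close>.\<close>

lemma accum_split:
  assumes l: "d < 2 ^ l"
  shows "(first_linf xs = 0 \<longrightarrow> accum d l \<sigma> xs = []) \<and>
    (first_linf xs \<noteq> 0 \<longrightarrow> (\<exists>R. accum d l \<sigma> xs = R @ phase_columns d l \<sigma> xs \<and>
      (\<forall>i<d. colsq R i \<le> cover_bound l * (\<Sum>k<phase d xs. (\<sigma> (first_linf xs) k)\<^sup>2))))"
proof (induction xs rule: rev_induct)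
  case Nil
  show ?case by (simp add: accum_Nil first_linf_def)
next
  case (snoc x xs)
  let ?ys = "xs @ [x]"
  have nn: "0 \<le> cover_bound l * (\<Sum>k<n. (\<sigma> \<beta> k)\<^sup>2)" for n \<beta>
    using cover_bound_pos[of l] by (intro mult_nonneg_nonneg sum_nonneg) auto
  consider "first_linf ?ys = 0" | "first_linf ?ys \<noteq> 0" "first_linf xs = 0"
    | "first_linf xs \<noteq> 0" "phase d xs = phase d ?ys" | "first_linf xs \<noteq> 0" "phase d xs \<noteq> phase d ?ys" by blast
  thus ?case
  proof cases
    case 1
    hence "first_linf xs = 0" by (simp add: first_linf_snoc split: if_splits)
    thus ?thesis using snoc 1 by (simp add: accum_snoc appended_def)
  next
    case 2
    hence "accum d l \<sigma> ?ys = [] @ phase_columns d l \<sigma> ?ys" using snoc by (simp add: accum_snoc appended_def)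
    thus ?thesis using 2(1) nn by (auto simp: colsq_def intro!: exI[of _ "[]"])
  next
    case 3
    hence bs: "first_linf ?ys = first_linf xs" by (simp add: first_linf_snoc)
    obtain R where R: "accum d l \<sigma> xs = R @ phase_columns d l \<sigma> xs"
        "\<forall>i<d. colsq R i \<le> cover_bound l * (\<Sum>k<phase d xs. (\<sigma> (first_linf xs) k)\<^sup>2)" using snoc 3 by auto
    obtain D where "out (run d l (map (\<lambda>x i. x ! i / guess d xs) ?ys)) = out (run d l (map (\<lambda>x i. x ! i / guess d xs) xs)) @ D"
      using out_run_snoc[of d l "map (\<lambda>x i. x ! i / guess d xs) xs"] by auto
    hence "\<exists>D. phase_columns d l \<sigma> ?ys = phase_columns d l \<sigma> xs @ D"
      using bs 3 by (simp add: phase_columns_def guess_def)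
    hence "accum d l \<sigma> ?ys = R @ phase_columns d l \<sigma> ?ys"
      using 3 bs R(1) by (auto simp: accum_snoc appended_def)
    thus ?thesis using R(2) 3 bs by auto
  next
    case 4
    hence bs: "first_linf ?ys = first_linf xs" by (simp add: first_linf_snoc)
    have pos: "0 < first_linf xs" using 4 first_linf_nonneg[of xs] by simp
    have lt: "phase d xs < phase d ?ys" using phase_mono[OF pos bs, of d] 4 by (simp add: le_neq_implies_less subset_insertI)
    obtain R where R: "accum d l \<sigma> xs = R @ phase_columns d l \<sigma> xs"
        "\<forall>i<d. colsq R i \<le> cover_bound l * (\<Sum>k<phase d xs. (\<sigma> (first_linf xs) k)\<^sup>2)" using snoc 4 by auto
    have "colsq (R @ phase_columns d l \<sigma> xs) i \<le> cover_bound l * (\<Sum>k<phase d ?ys. (\<sigma> (first_linf ?ys) k)\<^sup>2)" if i: "i < d" for i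
    proof -
      have "colsq (R @ phase_columns d l \<sigma> xs) i \<le> cover_bound l * (\<Sum>k<Suc (phase d xs). (\<sigma> (first_linf xs) k)\<^sup>2)"
        using R(2)[rule_format, OF i] colsq_phase_columns[OF pos l i, of \<sigma>] by (simp add: colsq_append distrib_left)
      also have "\<dots> \<le> cover_bound l * (\<Sum>k<phase d ?ys. (\<sigma> (first_linf xs) k)\<^sup>2)"
        using lt cover_bound_pos[of l] by (intro mult_left_mono sum_mono2) auto
      finally show ?thesis by (simp add: bs)
    qed
    moreover have "accum d l \<sigma> ?ys = (R @ phase_columns d l \<sigma> xs) @ phase_columns d l \<sigma> ?ys"
      using 4 bs R(1) by (simp add: accum_snoc appended_def)
    ultimately show ?thesis using 4(1) unfolding bs by blast
  qed
qed

lemma colsq_accum: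
  assumes l: "d < 2 ^ l" and i: "i < d"
  shows "colsq (accum d l \<sigma> xs) i \<le> accum_bound d l \<sigma> xs"
proof (cases "first_linf xs = 0")
  case True
  thus ?thesis using accum_split[OF l, of xs \<sigma>] by (simp add: accum_bound_def colsq_def)
next
  case False
  hence pos: "0 < first_linf xs" using first_linf_nonneg[of xs] by simp
  obtain R where R: "accum d l \<sigma> xs = R @ phase_columns d l \<sigma> xs"
      "colsq R i \<le> cover_bound l * (\<Sum>k<phase d xs. (\<sigma> (first_linf xs) k)\<^sup>2)" using accum_split[OF l, of xs \<sigma>] False i by auto
  show ?thesis
    using R(2) colsq_phase_columns[OF pos l i, of \<sigma>] False
    by (simp add: R(1) colsq_append accum_bound_def lessThan_Suc_atMost[symmetric] distrib_left)
qed

lemma norm2_nth: "norm2 r = sqrt (\<Sum>j<length r. (r ! j)\<^sup>2)"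
  unfolding norm2_def by (subst sum_list_sum_nth) (simp add: atLeast0LessThan)

lemma answer_exists:
  assumes l: "d < 2 ^ l" and \<sigma>: "\<And>b k. 0 < b \<Longrightarrow> 0 < \<sigma> b k"
    and xs: "xs \<noteq> []" "\<And>x. x \<in> set xs \<Longrightarrow> length x = d"
  shows "\<exists>r. is_answer d l \<sigma> xs r"
proof (cases "first_linf xs = 0")
  case True
  have "linf (last xs) = 0" using first_linf_0[OF True] xs by simp
  hence "last xs ! i = 0" if "i < d" for i
    using abs_le_linf[of i "last xs"] that xs by simp
  hence "last xs = map (\<lambda>i. 0) [0..<d]" using xs by (intro nth_equalityI) auto
  moreover have "accum d l \<sigma> xs = []" using accum_split[OF l, of xs \<sigma>] True by blast
  ultimately show ?thesis
    by (intro exI[of _ "[]"]) (simp add: is_answer_def vecmat_def norm2_def answer_bound_def guess_def True)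
next
  case False
  hence pos: "0 < first_linf xs" using first_linf_nonneg[of xs] by simp
  define s where "s = \<sigma> (first_linf xs) (phase d xs)"
  have s: "0 < s" using \<sigma>[OF pos] by (simp add: s_def)
  define g where "g = guess d xs"
  have g: "0 < g" using guess_pos[OF pos] by (simp add: g_def)
  define C where "C = out (run d l (map (\<lambda>x i. x ! i / guess d xs) xs))"
  obtain P b where cmp: "comparator d P b" "\<forall>x\<in>set (map (\<lambda>x i. x ! i / guess d xs) xs). dominated d P b x"
    using normalized_comparator[OF pos, of d] .
  have "covers d C (real l + 1) (last (map (\<lambda>x i. x ! i / g) xs))"
    unfolding C_def g_def using cmp xs(1) by (intro run_covers[OF _ _ l]) auto
  hence "covers d C (real l + 1) (\<lambda>i. last xs ! i / g)"
    using xs(1) by (simp add: last_map)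
  then obtain r where r: "(\<Sum>j<length C. (r j)\<^sup>2) \<le> (real l + 1)\<^sup>2" "\<And>i. i < d \<Longrightarrow> (\<Sum>j<length C. r j * (C ! j) i) = last xs ! i / g"
    by (auto simp: covers_def)
  obtain R where R: "accum d l \<sigma> xs = R @ phase_columns d l \<sigma> xs" using accum_split[OF l, of xs \<sigma>] False by auto
  have phase_columns: "length (phase_columns d l \<sigma> xs) = length C" "\<And>j i. j < length C \<Longrightarrow> i < d \<Longrightarrow> phase_columns d l \<sigma> xs ! j ! i = s * (C ! j) i"
    by (simp_all add: phase_columns_def C_def s_def)
  \<comment> \<open>The coefficients vanish on abandoned phases; on the current one they undo the
    division by the guess \<open>g\<close> and the multiplication by \<open>s\<close>.\<close>
  define q where "q = replicate (length R) 0 @ map (\<lambda>j. r j * (g / s)) [0..<length C]"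
  have q: "length q = length R + length C" "\<And>j. j < length R \<Longrightarrow> q ! j = 0" "\<And>j. j < length C \<Longrightarrow> q ! (length R + j) = r j * (g / s)"
    by (simp_all add: q_def nth_append)
  have "vecmat q (accum d l \<sigma> xs) d = last xs"
  proof (rule nth_equalityI)
    show "length (vecmat q (accum d l \<sigma> xs) d) = length (last xs)" using xs by (simp add: vecmat_def)
    fix i assume "i < length (vecmat q (accum d l \<sigma> xs) d)"
    hence i: "i < d" by (simp add: vecmat_def)
    have "vecmat q (accum d l \<sigma> xs) d ! i = (\<Sum>j<length R + length C. q ! j * (accum d l \<sigma> xs ! j ! i))"
      using i by (simp add: vecmat_def R phase_columns(1))
    also have "\<dots> = (\<Sum>j<length C. g * (r j * (C ! j) i))"
      using q phase_columns(2)[OF _ i] s by (simp add: sum_lessThan_add R nth_append mult_ac)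
    also have "\<dots> = last xs ! i"
      using r(2)[OF i] g by (simp add: sum_distrib_left[symmetric] mult.assoc)
    finally show "vecmat q (accum d l \<sigma> xs) d ! i = last xs ! i" .
  qed
  moreover have "norm2 q \<le> answer_bound d l \<sigma> xs"
  proof -
    have "(\<Sum>j<length q. (q ! j)\<^sup>2) = (g / s)\<^sup>2 * (\<Sum>j<length C. (r j)\<^sup>2)"
      using q by (simp add: sum_lessThan_add power_mult_distrib sum_distrib_right[symmetric] del: times_divide_eq_right)
    also have "\<dots> \<le> (g / s)\<^sup>2 * (real l + 1)\<^sup>2" using r(1) by (intro mult_left_mono) simp_all
    also have "\<dots> = ((real l + 1) * g / s)\<^sup>2" by (simp add: power_mult_distrib power_divide)
    finally show ?thesis
      unfolding norm2_nth answer_bound_def g_def[symmetric] s_def[symmetric] using g s by (intro real_le_lsqrt) (simp_all add: sum_nonneg)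
  qed
  ultimately show ?thesis
    using q(1) phase_columns(1) by (intro exI[of _ q]) (simp add: is_answer_def R)
qed

lemma acc_mat_online: "t \<le> length xs \<Longrightarrow> acc_mat (online d l \<sigma>) xs t = accum d l \<sigma> (take t xs)"
proof -
  assume t: "t \<le> length xs"
  have eq: "map (\<lambda>i. appended d l \<sigma> (take i xs)) [1..<Suc t] = map (\<lambda>i. appended d l \<sigma> (take i (take t xs))) [1..<Suc t]"
    by (intro map_cong) (auto simp: min_def)
  show ?thesis
    unfolding acc_mat_def online_def accum_def fst_conv snd_conv length_take min_absorb2[OF t] eq by simp
qed

lemma out_vec_online:
  assumes l: "d < 2 ^ l" and \<sigma>: "\<And>b k. 0 < b \<Longrightarrow> 0 < \<sigma> b k"
    and xs: "\<And>x. x \<in> set xs \<Longrightarrow> length x = d" and t: "1 \<le> t" "t \<le> length xs"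
  shows "is_answer d l \<sigma> (take t xs) (out_vec (online d l \<sigma>) xs t)"
proof -
  have "\<exists>r. is_answer d l \<sigma> (take t xs) r"
    using xs t by (intro answer_exists[OF l \<sigma>]) (auto dest: in_set_takeD)
  thus ?thesis unfolding out_vec_def online_def by (simp add: someI_ex)
qed

section \<open>Factorizations and the final bounds\<close>

text \<open>Cauchy-Schwarz, applied to the coefficients and the numbers
  \<open>dot d u (\<beta> p)\<close>.\<close>

lemma dominated_factor:
  assumes x: "\<And>i. i < d \<Longrightarrow> x i = (\<Sum>p<k. \<alpha> p * \<beta> p i)" and \<alpha>: "(\<Sum>p<k. (\<alpha> p)\<^sup>2) \<le> A\<^sup>2"
  shows "dominated d k (\<lambda>p i. A * \<beta> p i) x"
  unfolding dominated_def
proof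
  fix u
  have "dot d u x = (\<Sum>i<d. \<Sum>p<k. u i * (\<alpha> p * \<beta> p i))"
    by (simp add: dot_def x sum_distrib_left)
  also have "\<dots> = (\<Sum>p<k. \<Sum>i<d. u i * (\<alpha> p * \<beta> p i))" by (rule sum.swap)
  also have "\<dots> = (\<Sum>p<k. \<alpha> p * dot d u (\<beta> p))"
    by (simp add: dot_def sum_distrib_left mult_ac)
  finally have "(dot d u x)\<^sup>2 \<le> (\<Sum>p<k. (\<alpha> p)\<^sup>2) * (\<Sum>p<k. (dot d u (\<beta> p))\<^sup>2)"
    using Cauchy_Schwarz_ineq_sum[of \<alpha> "\<lambda>p. dot d u (\<beta> p)" "{..<k}"] by simp
  also have "\<dots> \<le> A\<^sup>2 * (\<Sum>p<k. (dot d u (\<beta> p))\<^sup>2)"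
    using \<alpha> by (intro mult_right_mono) (simp_all add: sum_nonneg)
  also have "\<dots> = (\<Sum>p<k. (dot d u (\<lambda>i. A * \<beta> p i))\<^sup>2)"
    by (simp add: dot_scale_right power_mult_distrib sum_distrib_left)
  finally show "(dot d u x)\<^sup>2 \<le> (\<Sum>p<k. (dot d u (\<lambda>i. A * \<beta> p i))\<^sup>2)" .
qed

lemma norm2_le_2toinf: "l \<in> set L \<Longrightarrow> norm2 l \<le> norm_2toinf L"
  by (simp add: norm_2toinf_def)

lemma norm_2toinf_nonneg: "0 \<le> norm_2toinf L"
  by (simp add: norm_2toinf_def)

lemma norm_1to2_nonneg: "0 \<le> norm_1to2 R N"
  by (simp add: norm_1to2_def)

lemma norm2_col: "norm2 (col j R) = sqrt (colsq R j)"
  by (simp add: norm2_def col_def colsq_def o_def)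

lemma colsq_nth: "colsq R i = (\<Sum>p<length R. (R ! p ! i)\<^sup>2)"
  unfolding colsq_def by (subst sum_list_sum_nth) (simp add: atLeast0LessThan)

lemma colsq_nonneg: "0 \<le> colsq R i"
  by (simp add: colsq_nth sum_nonneg)

lemma colsq_le_1to2:
  assumes "j < N" shows "colsq R j \<le> (norm_1to2 R N)\<^sup>2"
proof -
  have "sqrt (colsq R j) \<le> norm_1to2 R N"
    unfolding norm_1to2_def using assms by (intro Max_ge) (auto simp: norm2_col)
  thus ?thesis by (rule sqrt_le_D)
qed

lemma norm_1to2_le:
  assumes "0 \<le> B" "\<And>j. j < N \<Longrightarrow> colsq R j \<le> B\<^sup>2"
  shows "norm_1to2 R N \<le> B"
  unfolding norm_1to2_def using assms by (auto simp: norm2_col intro!: real_le_lsqrt colsq_nonneg)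

lemma sumsq_le_norm2: "norm2 l \<le> A \<Longrightarrow> (\<Sum>p<length l. (l ! p)\<^sup>2) \<le> A\<^sup>2"
  unfolding norm2_nth by (rule sqrt_le_D)

text \<open>The factorization through the identity matrix, so that \<open>gamma2\<close> is an
  infimum over a nonempty set.\<close>

lemma factorization_exists:
  assumes "is_mat (length Q) N Q"
  shows "\<exists>L R k. is_mat (length Q) k L \<and> is_mat k N R \<and> matmul L R N = Q"
proof -
  define I :: "real list list" where "I = map (\<lambda>i. map (\<lambda>j. if i = j then 1 else 0) [0..<N]) [0..<N]"
  have "vecmat q I N = q" if "q \<in> set Q" for q
  proof (rule nth_equalityI)
    show "length (vecmat q I N) = length q" using assms that by (simp add: vecmat_def is_mat_def)
    fix j assume "j < length (vecmat q I N)"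
    hence j: "j < N" by (simp add: vecmat_def)
    have "vecmat q I N ! j = (\<Sum>i<N. if i = j then q ! i else 0)"
      using j by (simp add: vecmat_def I_def if_distrib[of "\<lambda>x. _ * x"] cong: if_cong)
    thus "vecmat q I N ! j = q ! j" using j by simp
  qed
  hence "matmul Q I N = Q" by (simp add: matmul_def map_idI)
  moreover have "is_mat N N I" by (auto simp: is_mat_def I_def)
  ultimately show ?thesis using assms by blast
qed

lemma gamma2_less:
  assumes "is_mat (length Q) N Q" "gamma2 Q N < g"
  obtains L R k where "is_mat (length Q) k L" "is_mat k N R" "matmul L R N = Q" "norm_2toinf L * norm_1to2 R N < g"
proof -
  have "{norm_2toinf L * norm_1to2 R N | L R k. is_mat (length Q) k L \<and> is_mat k N R \<and> matmul L R N = Q} \<noteq> {}"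
    using factorization_exists[OF assms(1)] by blast
  from cInf_lessD[OF this assms(2)[unfolded gamma2_def]] show ?thesis using that by blast
qed

lemma gamma2_nonneg:
  assumes "is_mat (length Q) N Q" shows "0 \<le> gamma2 Q N"
  unfolding gamma2_def using factorization_exists[OF assms]
  by (intro cInf_greatest) (auto intro!: mult_nonneg_nonneg norm_2toinf_nonneg norm_1to2_nonneg)

text \<open>The rows of \<open>Q\<close> are combinations of the rows of \<open>R\<close>, so the
  comparator is \<open>R\<^sup>T R\<close> times the square of \<open>norm_2toinf L\<close>.\<close>

lemma coverable_rows:
  assumes Q: "is_mat (length Q) N Q" "gamma2 Q N < g"
  shows "coverable N g Q"
proof -
  obtain L R k where LR: "is_mat (length Q) k L" "is_mat k N R" "matmul L R N = Q" "norm_2toinf L * norm_1to2 R N < g"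
    using gamma2_less[OF Q] .
  let ?A = "norm_2toinf L"
  have "dominated N k (\<lambda>p i. ?A * R ! p ! i) ((!) q)" if q: "q \<in> set Q" for q
  proof -
    obtain v where v: "v \<in> set L" "q = vecmat v R N" using q unfolding LR(3)[symmetric] matmul_def by auto
    have "length v = k" "length R = k" using LR v by (auto simp: is_mat_def)
    thus ?thesis
      using sumsq_le_norm2[OF norm2_le_2toinf[OF v(1)]]
      by (intro dominated_factor[where \<alpha> = "(!) v"]) (auto simp: v(2) vecmat_def)
  qed
  moreover have "(\<Sum>p<k. (?A * R ! p ! i)\<^sup>2) \<le> g\<^sup>2" if "i < N" for i
  proof -
    have "length R = k" using LR by (auto simp: is_mat_def)
    hence "(\<Sum>p<k. (?A * R ! p ! i)\<^sup>2) = ?A\<^sup>2 * colsq R i"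
      by (simp add: power_mult_distrib sum_distrib_left colsq_nth)
    also have "\<dots> \<le> ?A\<^sup>2 * (norm_1to2 R N)\<^sup>2" using colsq_le_1to2[OF that] by (intro mult_left_mono) simp_all
    also have "\<dots> \<le> g\<^sup>2"
      unfolding power_mult_distrib[symmetric] using LR(4) norm_2toinf_nonneg norm_1to2_nonneg by (intro power_mono) auto
    finally show ?thesis .
  qed
  ultimately show ?thesis unfolding coverable_def by (intro exI[of _ k] exI[of _ "\<lambda>p i. ?A * R ! p ! i"]) blast
qed

lemma is_mat_rows_of_cols: "is_mat m (length as) (rows_of_cols m as)"
  by (auto simp: is_mat_def rows_of_cols_def)

lemma length_rows_of_cols: "length (rows_of_cols m as) = m"
  by (simp add: rows_of_cols_def)

text \<open>The transposed choice: the comparator is \<open>L L\<^sup>T\<close> times the square of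
  the norm of \<open>R\<close>.\<close>

lemma coverable_columns:
  assumes g: "gamma2 (rows_of_cols m as) (length as) < g"
  shows "coverable m g as"
proof -
  obtain L R k where LR: "is_mat m k L" "is_mat k (length as) R" "matmul L R (length as) = rows_of_cols m as"
      "norm_2toinf L * norm_1to2 R (length as) < g"
    using gamma2_less[of "rows_of_cols m as" "length as" g] g is_mat_rows_of_cols[of m as]
    unfolding length_rows_of_cols by blast
  let ?B = "norm_1to2 R (length as)"
  have len: "length L = m" "length R = k" "\<And>i. i < m \<Longrightarrow> length (L ! i) = k" using LR by (auto simp: is_mat_def)
  have "dominated m k (\<lambda>p i. ?B * L ! i ! p) ((!) a)" if a: "a \<in> set as" for a
  proof -
    obtain j where j: "j < length as" "a = as ! j" using a by (auto simp: in_set_conv_nth)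
    have "a ! i = (\<Sum>p<k. R ! p ! j * L ! i ! p)" if i: "i < m" for i
    proof -
      have "a ! i = rows_of_cols m as ! i ! j" using i j by (simp add: rows_of_cols_def)
      also have "\<dots> = vecmat (L ! i) R (length as) ! j"
        unfolding LR(3)[symmetric] using i len by (simp add: matmul_def)
      finally show ?thesis using j len by (simp add: vecmat_def mult.commute)
    qed
    thus ?thesis
      using colsq_le_1to2[OF j(1), of R]
      by (intro dominated_factor[where \<alpha> = "\<lambda>p. R ! p ! j"]) (auto simp: colsq_nth len)
  qed
  moreover have "(\<Sum>p<k. (?B * L ! i ! p)\<^sup>2) \<le> g\<^sup>2" if i: "i < m" for i
  proof -
    have "(\<Sum>p<k. (?B * L ! i ! p)\<^sup>2) = ?B\<^sup>2 * (\<Sum>p<length (L ! i). (L ! i ! p)\<^sup>2)"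
      by (simp add: power_mult_distrib sum_distrib_left len i)
    also have "\<dots> \<le> ?B\<^sup>2 * (norm_2toinf L)\<^sup>2"
      using i len by (intro mult_left_mono sumsq_le_norm2 norm2_le_2toinf) auto
    also have "\<dots> \<le> g\<^sup>2"
      unfolding power_mult_distrib[symmetric] using LR(4) norm_2toinf_nonneg norm_1to2_nonneg
      by (intro power_mono) (auto simp: mult.commute)
    finally show ?thesis .
  qed
  ultimately show ?thesis unfolding coverable_def by (intro exI[of _ k] exI[of _ "\<lambda>p i. ?B * L ! i ! p"]) blast
qed

section \<open>Dyadic depth and numerical constants\<close>

definition depth :: "nat \<Rightarrow> nat" where
  "depth d = nat \<lfloor>log 2 (max 2 (real d))\<rfloor> + 1"

lemma less_power_depth: "d < 2 ^ depth d"
proof -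
  have "real d \<le> max 2 (real d)" by simp
  also have "\<dots> = 2 powr log 2 (max 2 (real d))" by simp
  also have "\<dots> < 2 powr real (depth d)"
    unfolding depth_def by (intro powr_less_mono) linarith+
  finally have "real d < real (2 ^ depth d)" by (simp add: powr_realpow)
  thus ?thesis by (simp only: of_nat_less_iff)
qed

lemma depth_le: "real (depth d) \<le> 3 * ln (max 2 (real d))"
proof -
  define x where "x = max 2 (real d)"
  have x: "2 \<le> x" by (simp add: x_def)
  hence ln: "2 / 3 \<le> ln x" using ln2_ge_two_thirds ln_mono[of 2 x] by linarith
  have "real (depth d) \<le> log 2 x + 1"
    using x zero_le_log_cancel_iff[of 2 x] unfolding depth_def x_def[symmetric] by (simp add: le_nat_floor)
  also have "log 2 x \<le> ln x / (2 / 3)"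
    unfolding log_def using ln ln2_ge_two_thirds by (intro divide_left_mono) auto
  finally show ?thesis using ln by (simp add: x_def)
qed

text \<open>The product of the two costs of covering, \<open>l + 1\<close> for the coefficients and
  the square root of \<open>cover_bound l\<close> for the columns. The scaling
  \<open>\<sigma>\<close> only shifts cost between them.\<close>

definition loss :: "nat \<Rightarrow> real" where
  "loss d = (real (depth d) + 1) * sqrt (cover_bound (depth d))"

lemma loss_nonneg: "0 \<le> loss d"
  using cover_bound_pos[of "depth d"] by (simp add: loss_def)

lemma loss_le: "loss d \<le> 1276 * ln (max 2 (real d)) ^ 3"
proof -
  define l where "l = real (depth d)"
  define x where "x = ln (max 2 (real d))"
  have x: "2 / 3 \<le> x" using ln2_ge_two_thirds ln_mono[of 2 "max 2 (real d)"] unfolding x_def by linarith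
  have l: "0 \<le> l" "l \<le> 3 * x" using depth_le[of d] by (simp_all add: l_def x_def)
  have "cover_bound (depth d) \<le> ((l + 1) * (7 * (l + 4)))\<^sup>2"
  proof -
    have "0 \<le> l\<^sup>2 + 8 * l + 14" using l by simp
    hence "48 * (l + 4)\<^sup>2 + 2 \<le> (7 * (l + 4))\<^sup>2" by (simp add: power2_eq_square algebra_simps)
    hence "(l + 1)\<^sup>2 * (48 * (l + 4)\<^sup>2 + 2) \<le> (l + 1)\<^sup>2 * (7 * (l + 4))\<^sup>2" by (intro mult_left_mono) simp_all
    thus ?thesis by (simp add: cover_bound_def threshold_def l_def power_mult_distrib)
  qed
  hence "sqrt (cover_bound (depth d)) \<le> (l + 1) * (7 * (l + 4))"
    using l by (intro real_le_lsqrt) (simp_all add: less_imp_le[OF cover_bound_pos])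
  hence "loss d \<le> (l + 1) * ((l + 1) * (7 * (l + 4)))"
    unfolding loss_def l_def[symmetric] using l by (intro mult_left_mono) simp_all
  \<comment> \<open>As \<open>x\<close> is at least \<open>2 / 3\<close>, both
    \<open>l + 1 \<le> 9 / 2 * x\<close> and \<open>l + 4 \<le> 9 * x\<close> hold; the constants
    multiply to 1275.75.\<close>
  also have "\<dots> \<le> (9 / 2 * x) * ((9 / 2 * x) * (7 * (9 * x)))"
    using l x by (intro mult_mono) auto
  also have "\<dots> \<le> 1276 * x ^ 3" using x by (simp add: power3_eq_cube)
  finally show ?thesis by (simp add: x_def)
qed

lemma max_insert_le: "finite A \<Longrightarrow> 0 \<le> B \<Longrightarrow> (\<And>x. x \<in> A \<Longrightarrow> f x \<le> B) \<Longrightarrow> Max (insert 0 (f ` A)) \<le> (B :: real)"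
  by simp

lemma accum_props:
  assumes \<sigma>: "\<forall>b>0. \<forall>k. 0 < \<sigma> b k" and qs: "\<forall>q\<in>set qs. length q = d"
  shows "t \<le> length qs \<Longrightarrow> is_mat (length (acc_mat (online d (depth d) \<sigma>) qs t)) d (acc_mat (online d (depth d) \<sigma>) qs t)"
    and "t \<le> length qs \<Longrightarrow> i < d \<Longrightarrow> colsq (acc_mat (online d (depth d) \<sigma>) qs t) i \<le> accum_bound d (depth d) \<sigma> (take t qs)"
    and "1 \<le> t \<Longrightarrow> t \<le> length qs \<Longrightarrow> length (out_vec (online d (depth d) \<sigma>) qs t) = length (acc_mat (online d (depth d) \<sigma>) qs t)
      \<and> vecmat (out_vec (online d (depth d) \<sigma>) qs t) (acc_mat (online d (depth d) \<sigma>) qs t) d = qs ! (t - 1)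
      \<and> norm2 (out_vec (online d (depth d) \<sigma>) qs t) \<le> answer_bound d (depth d) \<sigma> (take t qs)"
proof -
  assume t: "t \<le> length qs"
  show "is_mat (length (acc_mat (online d (depth d) \<sigma>) qs t)) d (acc_mat (online d (depth d) \<sigma>) qs t)"
    unfolding is_mat_def acc_mat_online[OF t] using length_accum by auto
  show "colsq (acc_mat (online d (depth d) \<sigma>) qs t) i \<le> accum_bound d (depth d) \<sigma> (take t qs)" if "i < d"
    unfolding acc_mat_online[OF t] by (rule colsq_accum[OF less_power_depth that])
next
  assume t: "1 \<le> t" "t \<le> length qs"
  have "take t qs \<noteq> []" using t by auto
  hence "last (take t qs) = qs ! (t - 1)" using t by (simp add: last_conv_nth min_absorb2)
  thus "length (out_vec (online d (depth d) \<sigma>) qs t) = length (acc_mat (online d (depth d) \<sigma>) qs t)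
      \<and> vecmat (out_vec (online d (depth d) \<sigma>) qs t) (acc_mat (online d (depth d) \<sigma>) qs t) d = qs ! (t - 1)
      \<and> norm2 (out_vec (online d (depth d) \<sigma>) qs t) \<le> answer_bound d (depth d) \<sigma> (take t qs)"
    using out_vec_online[OF less_power_depth _ _ t, of \<sigma> d] \<sigma> qs unfolding is_answer_def acc_mat_online[OF t(2)] by simp
qed

text \<open>With \<open>\<sigma>\<close> proportional to the guess, the answers have norm at most 1.
  The squared norms of all phases form a geometric series dominated by the last guess, which is at
  most \<open>2 * \<gamma>\<close>, so guessing costs only a constant factor.\<close>

lemma column_arrival:
  "\<exists>alg. col_valid m alg \<and> (\<forall>as. (\<forall>a\<in>set as. length a = m) \<longrightarrow>
     col_value m alg as \<le> 5104 * gamma2 (rows_of_cols m as) (length as) * ln (max 2 (real m)) ^ 3)"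
proof -
  let ?l = "depth m"
  define \<sigma> where "\<sigma> b k = (real ?l + 1) * (b * 2 ^ k)" for b :: real and k :: nat
  have \<sigma>: "\<forall>b>0. \<forall>k. 0 < \<sigma> b k" by (simp add: \<sigma>_def add_nonneg_pos)
  let ?alg = "online m ?l \<sigma>"
  have ans: "answer_bound m ?l \<sigma> xs \<le> 1" for xs
  proof (cases "first_linf xs = 0")
    case True
    thus ?thesis by (simp add: answer_bound_def guess_def)
  next
    case False
    hence "0 < first_linf xs" using first_linf_nonneg[of xs] by simp
    hence "0 < (real ?l + 1) * guess m xs" by (simp add: guess_pos add_nonneg_pos)
    thus ?thesis by (simp add: answer_bound_def \<sigma>_def guess_def[symmetric])
  qed
  have "col_valid m ?alg"
    unfolding col_valid_def
  proof (intro allI impI conjI; (elim conjE)?)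
    fix as :: "real list list" and t assume as: "\<forall>a\<in>set as. length a = m"
    note P = accum_props[where \<sigma> = \<sigma>, OF \<sigma> as]
    show "is_mat (length (acc_mat ?alg as t)) m (acc_mat ?alg as t)" if "t \<le> length as" using P(1)[OF that] .
    assume t: "1 \<le> t" "t \<le> length as"
    show "length (out_vec ?alg as t) = length (acc_mat ?alg as t)"
      "vecmat (out_vec ?alg as t) (acc_mat ?alg as t) m = as ! (t - 1)" using P(3)[OF t] by simp_all
    show "norm2 (out_vec ?alg as t) \<le> 1" using P(3)[OF t] ans[of "take t as"] by linarith
  qed
  moreover have "col_value m ?alg as \<le> 5104 * gamma2 (rows_of_cols m as) (length as) * ln (max 2 (real m)) ^ 3"
    if as: "\<forall>a\<in>set as. length a = m" for as
  proof -
    define \<gamma> where "\<gamma> = gamma2 (rows_of_cols m as) (length as)"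
    have \<gamma>: "0 \<le> \<gamma>" using gamma2_nonneg[of "rows_of_cols m as"] is_mat_rows_of_cols[of m as]
      by (simp add: \<gamma>_def length_rows_of_cols)
    have "accum_bound m ?l \<sigma> as \<le> (4 * loss m * \<gamma>)\<^sup>2"
    proof (cases "first_linf as = 0")
      case False
      hence pos: "0 < first_linf as" using first_linf_nonneg[of as] by simp
      have guess: "guess m as \<le> 2 * \<gamma>"
        using as coverable_columns by (intro guess_le[OF pos _ \<gamma>]) (auto simp: \<gamma>_def)
      have geo: "(\<Sum>k\<le>n. (2 ^ k)\<^sup>2) \<le> 2 * (2 ^ n :: real)\<^sup>2" for n :: nat
      proof (induction n)
        case (Suc n)
        have four: "2 * (2 ^ n)\<^sup>2 \<le> (4 * (2 ^ n)\<^sup>2 :: real)" by (intro mult_right_mono) simp_all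
        show ?case
          using order_trans[OF Suc.IH four] by (simp add: power_mult_distrib)
      qed simp
      have "(\<Sum>k\<le>phase m as. (\<sigma> (first_linf as) k)\<^sup>2) = ((real ?l + 1) * first_linf as)\<^sup>2 * (\<Sum>k\<le>phase m as. (2 ^ k)\<^sup>2)"
        by (simp add: \<sigma>_def power_mult_distrib sum_distrib_left mult.assoc)
      also have "\<dots> \<le> ((real ?l + 1) * first_linf as)\<^sup>2 * (2 * (2 ^ phase m as)\<^sup>2)"
        using geo by (intro mult_left_mono) simp_all
      also have "\<dots> = 2 * ((real ?l + 1) * guess m as)\<^sup>2"
        by (simp add: guess_def power_mult_distrib)
      \<comment> \<open>The factor 2 is relaxed to 4 to leave a perfect square.\<close>
      also have "\<dots> \<le> 4 * ((real ?l + 1) * (2 * \<gamma>))\<^sup>2"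
        using guess less_imp_le[OF guess_pos[OF pos]] by (intro mult_mono power_mono mult_left_mono) auto
      finally have "accum_bound m ?l \<sigma> as \<le> cover_bound ?l * (4 * ((real ?l + 1) * (2 * \<gamma>))\<^sup>2)"
        using False less_imp_le[OF cover_bound_pos[of ?l]] by (simp add: accum_bound_def mult_left_mono)
      also have "\<dots> = (4 * loss m * \<gamma>)\<^sup>2"
        using less_imp_le[OF cover_bound_pos[of ?l]] by (simp add: loss_def power_mult_distrib)
      finally show ?thesis .
    qed (simp add: accum_bound_def)
    hence "col_value m ?alg as \<le> 4 * loss m * \<gamma>"
      unfolding col_value_def using accum_props(2)[where \<sigma> = \<sigma>, OF \<sigma> as le_refl] \<gamma> loss_nonneg[of m]
      by (intro norm_1to2_le) (auto intro: order_trans)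
    also have "\<dots> \<le> 4 * (1276 * ln (max 2 (real m)) ^ 3) * \<gamma>"
      using loss_le[of m] \<gamma> by (intro mult_right_mono) simp_all
    finally show ?thesis by (simp add: \<gamma>_def mult_ac)
  qed
  ultimately show ?thesis by blast
qed

section \<open>Row arrival\<close>

lemma phase_le_ln:
  assumes "2 ^ n \<le> 2 * \<rho>"
  shows "real n + 1 \<le> 5 * ln (max 2 \<rho>)"
proof -
  define x where "x = ln (max 2 \<rho>)"
  have x: "ln 2 \<le> x" unfolding x_def by (intro ln_mono) auto
  have "real n * ln 2 = ln (2 ^ n)" by (simp add: ln_realpow)
  also have "\<dots> \<le> ln (2 * max 2 \<rho>)" using assms by (intro ln_mono) auto
  also have "\<dots> = ln 2 + x" by (simp add: ln_mult x_def)
  finally have "(real n + 1) * ln 2 \<le> 3 * x" using x by (simp add: distrib_right)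
  moreover have "(real n + 1) * (2 / 3) \<le> (real n + 1) * ln 2"
    using ln2_ge_two_thirds by (intro mult_left_mono) simp_all
  moreover have "0 \<le> x" using x ln2_ge_two_thirds by linarith
  ultimately show ?thesis by (simp add: x_def[symmetric])
qed

text \<open>The squares of \<open>\<sigma>\<close> are proportional to the summable weights
  \<open>\<omega>\<close>, which keeps the accumulated matrix within norm 1 over arbitrarily many
  phases. The price is a factor \<open>(k + 1) powr (1/2 + c)\<close> on the answers of phase
  \<open>k\<close>, and the phase is logarithmic in the ratio of \<open>gamma2\<close> to the norm
  of the first row.\<close>

lemma row_arrival:
  fixes c :: real
  assumes c: "0 < c"
  shows "\<exists>K::real. \<forall>N::nat. \<exists>alg. row_valid N alg \<and>
    (\<forall>Q. Q \<noteq> [] \<longrightarrow> is_mat (length Q) N Q \<longrightarrow> linf (hd Q) > 0 \<longrightarrow>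
       row_value alg Q \<le> K * gamma2 Q N * ln (max 2 (gamma2 Q N / linf (hd Q))) powr (1/2 + c) * ln (max 2 (real N)) ^ 3)"
proof -
  \<comment> \<open>The exponent \<open>1 + 2 * c\<close> exceeds 1, which gives summability; its
    half is the power of the logarithm in the bound.\<close>
  define \<omega> where "\<omega> k = real (Suc k) powr (- (1 + 2 * c))" for k
  define Z where "Z = suminf \<omega>"
  have \<omega>: "0 < \<omega> k" for k by (simp add: \<omega>_def)
  have "summable \<omega>"
    unfolding \<omega>_def summable_Suc_iff[of "\<lambda>k. real k powr (- (1 + 2 * c))"]
    using c by (subst summable_real_powr_iff) simp
  hence Z: "(\<Sum>k\<le>n. \<omega> k) \<le> Z" for n
    unfolding Z_def using \<omega> by (intro sum_le_suminf) (auto intro: less_imp_le)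
  have Zpos: "0 < Z" using Z[of 0] \<omega>[of 0] by simp
  show ?thesis
  proof (intro exI allI)
    fix N
    let ?l = "depth N"
    have cb: "0 < cover_bound ?l" by (rule cover_bound_pos)
    define \<sigma> where "\<sigma> b k = sqrt (\<omega> k / (Z * cover_bound ?l))" for b :: real and k :: nat
    have \<sigma>: "\<forall>b>0. \<forall>k. 0 < \<sigma> b k" using \<omega> Zpos cb by (simp add: \<sigma>_def)
    let ?alg = "online N ?l \<sigma>"
    have bound: "accum_bound N ?l \<sigma> xs \<le> 1" for xs
    proof -
      have "(\<sigma> b k)\<^sup>2 = \<omega> k / (Z * cover_bound ?l)" for b k
        using \<omega>[of k] Zpos cb by (simp add: \<sigma>_def)
      hence "cover_bound ?l * (\<Sum>k\<le>phase N xs. (\<sigma> (first_linf xs) k)\<^sup>2) = (\<Sum>k\<le>phase N xs. \<omega> k) / Z"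
        using cb by (simp add: sum_divide_distrib[symmetric])
      also have "\<dots> \<le> 1" using Z Zpos by simp
      finally show ?thesis by (simp add: accum_bound_def)
    qed
    have "row_valid N ?alg"
      unfolding row_valid_def
    proof (intro allI impI conjI; (elim conjE)?)
      fix qs :: "real list list" and t assume qs: "\<forall>q\<in>set qs. length q = N"
      note P = accum_props[where \<sigma> = \<sigma>, OF \<sigma> qs]
      show "is_mat (length (acc_mat ?alg qs t)) N (acc_mat ?alg qs t)" if "t \<le> length qs" using P(1)[OF that] .
      show "norm_1to2 (acc_mat ?alg qs t) N \<le> 1" if "t \<le> length qs"
        using P(2)[OF that] bound by (intro norm_1to2_le) (auto intro: order_trans)
      assume t: "1 \<le> t" "t \<le> length qs"
      show "length (out_vec ?alg qs t) = length (acc_mat ?alg qs t)"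
        "vecmat (out_vec ?alg qs t) (acc_mat ?alg qs t) N = qs ! (t - 1)" using P(3)[OF t] by simp_all
    qed
    moreover have "row_value ?alg Q \<le> (2552 * sqrt Z * 5 powr (1/2 + c)) * gamma2 Q N
        * ln (max 2 (gamma2 Q N / linf (hd Q))) powr (1/2 + c) * ln (max 2 (real N)) ^ 3"
      if Q: "Q \<noteq> []" "is_mat (length Q) N Q" "linf (hd Q) > 0" for Q
    proof -
      define \<gamma> where "\<gamma> = gamma2 Q N"
      define \<beta> where "\<beta> = linf (hd Q)"
      define x where "x = ln (max 2 (\<gamma> / \<beta>))"
      have \<gamma>: "0 \<le> \<gamma>" using gamma2_nonneg[OF Q(2)] by (simp add: \<gamma>_def)
      have x: "0 \<le> x" by (simp add: x_def)
      have len: "\<forall>q\<in>set Q. length q = N" using Q(2) by (simp add: is_mat_def)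
      have main: "norm2 (out_vec ?alg Q t) \<le> (1276 * ln (max 2 (real N)) ^ 3) * (2 * \<gamma>) * (sqrt Z * (5 * x) powr (1/2 + c))"
        if t: "t \<in> {1..length Q}" for t
      proof -
        let ?Q = "take t Q"
        obtain q Q' where QQ: "Q = q # Q'" using Q(1) by (cases Q) auto
        obtain t' where t': "t = Suc t'" using t by (cases t) auto
        have b: "first_linf ?Q = \<beta>" using Q(3) by (simp add: first_linf_def QQ t' \<beta>_def)
        have pos: "0 < first_linf ?Q" using b Q(3) by (simp add: \<beta>_def)
        have cov: "coverable N g ?Q" if "\<gamma> < g" for g
          using coverable_subset[OF coverable_rows[OF Q(2)] set_take_subset] that by (simp add: \<gamma>_def)
        have guess: "guess N ?Q \<le> 2 * \<gamma>"
          using len cov by (intro guess_le[OF pos _ \<gamma>]) (auto dest: in_set_takeD)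
        hence "2 ^ phase N ?Q \<le> 2 * (\<gamma> / \<beta>)"
          using pos by (simp add: guess_def b field_simps)
        from phase_le_ln[OF this] have ph: "real (Suc (phase N ?Q)) \<le> 5 * x" by (simp add: x_def add.commute)
        have "- (1 + 2 * c) * (1/2) = - (1/2 + c)" by simp
        hence "sqrt (\<omega> k) = real (Suc k) powr (- (1/2 + c))" for k
          unfolding \<omega>_def powr_half_sqrt[OF powr_ge_zero, symmetric] powr_powr by (simp only:)
        hence sq: "sqrt (\<omega> k) = inverse (real (Suc k) powr (1/2 + c))" for k
          by (simp only: powr_minus)
        have "(real ?l + 1) * g / \<sigma> b k = loss N * g * (sqrt Z * real (Suc k) powr (1/2 + c))" for g b k
          unfolding \<sigma>_def loss_def real_sqrt_divide real_sqrt_mult sq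
          by (simp only: divide_inverse inverse_mult_distrib inverse_inverse_eq mult_ac)
        hence "answer_bound N ?l \<sigma> ?Q = loss N * guess N ?Q * (sqrt Z * real (Suc (phase N ?Q)) powr (1/2 + c))"
          by (simp only: answer_bound_def)
        also have "\<dots> \<le> (1276 * ln (max 2 (real N)) ^ 3) * (2 * \<gamma>) * (sqrt Z * (5 * x) powr (1/2 + c))"
          using loss_le[of N] loss_nonneg[of N] guess guess_pos[OF pos, of N] ph Zpos c
          by (intro mult_mono powr_mono2) auto
        finally show ?thesis
          using accum_props(3)[where \<sigma> = \<sigma>, OF \<sigma> len, of t] t by auto
      qed
      have "row_value ?alg Q \<le> (1276 * ln (max 2 (real N)) ^ 3) * (2 * \<gamma>) * (sqrt Z * (5 * x) powr (1/2 + c))"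
        unfolding row_value_def using main \<gamma> Zpos by (intro max_insert_le) auto
      also have "\<dots> = (2552 * sqrt Z * 5 powr (1/2 + c)) * \<gamma> * x powr (1/2 + c) * ln (max 2 (real N)) ^ 3"
        using x by (simp add: powr_mult)
      finally show ?thesis by (simp add: \<gamma>_def x_def \<beta>_def)
    qed
    ultimately show "row_valid N ?alg \<and> (\<forall>Q. Q \<noteq> [] \<longrightarrow> is_mat (length Q) N Q \<longrightarrow> linf (hd Q) > 0 \<longrightarrow>
       row_value ?alg Q \<le> (2552 * sqrt Z * 5 powr (1/2 + c)) * gamma2 Q N
        * ln (max 2 (gamma2 Q N / linf (hd Q))) powr (1/2 + c) * ln (max 2 (real N)) ^ 3)" by blast
  qed
qed

theorem theorem1p5:
  shows "(\<forall>c::real. c > 0 \<longrightarrow>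
           (\<exists>K::real. \<forall>N::nat. \<exists>alg. row_valid N alg \<and>
              (\<forall>Q. Q \<noteq> [] \<longrightarrow> is_mat (length Q) N Q \<longrightarrow> linf (hd Q) > 0 \<longrightarrow>
                 row_value alg Q \<le> K * gamma2 Q N
                    * ln (max 2 (gamma2 Q N / linf (hd Q))) powr (1/2 + c)
                    * ln (max 2 (real N)) ^ 3)))
       \<and> (\<exists>K::real. \<forall>m::nat. \<exists>alg. col_valid m alg \<and>
              (\<forall>as. (\<forall>a\<in>set as. length a = m) \<longrightarrow>
                 col_value m alg as \<le> K * gamma2 (rows_of_cols m as) (length as)
                    * ln (max 2 (real m)) ^ 3))"
  using row_arrival column_arrival by blast

end
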